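(* Let $N\ge2$ and $0\ne q\in k$ with $[n]_q:=1+q+\cdots+q^{n-1}\ne0$ for all $n\ge1$. Let $V$ be a finite-dimensional vector superspace and $\mathscr R\colon V^{\otimes2}\to V^{\otimes2}$ a Hecke operator associated with $q$. Then the $N$-homogeneous superalgebra $\Lambda_{\mathscr R,N}=\mathsf T(V)/(R)$, with $R=\operatorname{Im}\rho_{N,\mathscr R}(X_N)\subseteq V^{\otimes N}$, is $N$-Koszul.
   Context: $k$ a field, $\operatorname{char}k\ne2$; vector superspaces with sign conventions. A Hecke operator associated with $q$ is an even linear map $\mathscr R\colon V^{\otimes2}\to V^{\otimes2}$ with $(\mathscr R+1)(\mathscr R-q)=0$ and $\mathscr R_1\mathscr R_2\mathscr R_1=\mathscr R_2\mathscr R_1\mathscr R_2$ where $\mathscr R_1=\mathscr R\otimes\mathrm{Id}_V$, $\mathscr R_2=\mathrm{Id}_V\otimes\mathscr R$. The Hecke algebra $\mathscr H_{n,q}$ is generated by $T_1,\dots,T_{n-1}$ with $(T_i+1)(T_i-q)=0$, $T_iT_{i+1}T_i=T_{i+1}T_iT_{i+1}$, $T_iT_j=T_jT_i$ for $|i-j|\ge2$; for $\sigma\in\mathfrak S_n$ with reduced expression $\sigma=\sigma_{i_1}\cdots\sigma_{i_r}$ ($\sigma_i=(i,i+1)$) put $T_\sigma=T_{i_1}\cdots T_{i_r}$. The $q$-symmetrizer is $X_n=\frac1{[n]_q!}\sum_{\sigma\in\mathfrak S_n}T_\sigma$, $[n]_q!=\prod_{i=1}^n[i]_q$. The representation $\rho_{n,\mathscr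 R}\colon\mathscr H_{n,q}\to\operatorname{End}(V^{\otimes n})$ is $\rho(T_i)=\mathrm{Id}_V^{\otimes(i-1)}\otimes\mathscr R\otimes\mathrm{Id}_V^{\otimes(n-i-1)}$. A connected graded algebra $\mathcal A$ (here graded by tensor degree) is $N$-Koszul if $\operatorname{Tor}^{\mathcal A}_i(k,k)$ is concentrated in degree $\nu_N(i)$ for all $i\ge0$, where $\nu_N(i)=\frac i2N$ for $i$ even and $\frac{i-1}2N+1$ for $i$ odd. *)

theory Defs
  imports "HOL-Combinatorics.Combinatorics"
begin

text \<open>
Concrete model.  V is a finite-dimensional vector superspace over the field 'k with a
homogeneous basis e_0, ..., e_(d-1); the parity of e_j is given by p j (True = odd).
An element of V^(tensor n) is a function on words (nat lists) supported on
words d n = words of length n over the alphabet {0..<d};  the word [j1,...,jn] stands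
for the basis tensor e_j1 (x) ... (x) e_jn.  Linear operators on V^(tensor n) are
matrices indexed by words.
\<close>

definition words :: "nat \<Rightarrow> nat \<Rightarrow> nat list set" where
  "words d n = {w. length w = n \<and> set w \<subseteq> {..<d}}"

definition tspace :: "nat \<Rightarrow> nat \<Rightarrow> (nat list \<Rightarrow> 'k::field) set" where
  "tspace d n = {f. \<forall>w. f w \<noteq> 0 \<longrightarrow> w \<in> words d n}"

definition lspan :: "(nat list \<Rightarrow> 'k::field) set \<Rightarrow> (nat list \<Rightarrow> 'k) set" where
  "lspan S = {v. \<exists>F a. finite F \<and> F \<subseteq> S \<and> v = (\<lambda>w. \<Sum>f\<in>F. a f * f w)}"

definition tens :: "nat \<Rightarrow> (nat list \<Rightarrow> 'k::field) \<Rightarrow> (nat list \<Rightarrow> 'k) \<Rightarrow> nat list \<Rightarrow> 'k" where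
  "tens a u v w = u (take a w) * v (drop a w)"

definition mat_id :: "nat list \<Rightarrow> nat list \<Rightarrow> 'k::field" where
  "mat_id w u = (if w = u then 1 else 0)"

definition mat_mul :: "nat \<Rightarrow> nat \<Rightarrow> (nat list \<Rightarrow> nat list \<Rightarrow> 'k::field)
    \<Rightarrow> (nat list \<Rightarrow> nat list \<Rightarrow> 'k) \<Rightarrow> nat list \<Rightarrow> nat list \<Rightarrow> 'k" where
  "mat_mul d n A B w u = (\<Sum>v\<in>words d n. A w v * B v u)"

definition mat_app :: "nat \<Rightarrow> nat \<Rightarrow> (nat list \<Rightarrow> nat list \<Rightarrow> 'k::field)
    \<Rightarrow> (nat list \<Rightarrow> 'k) \<Rightarrow> nat list \<Rightarrow> 'k" where
  "mat_app d n M f w = (if w \<in> words d n then (\<Sum>u\<in>words d n. M w u * f u) else 0)"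

definition wparity :: "(nat \<Rightarrow> bool) \<Rightarrow> nat list \<Rightarrow> bool" where
  "wparity p w = odd (length (filter p w))"

text \<open>rho_(n,R)(T_i) = Id^(i-1) (x) R (x) Id^(n-i-1), for 1 \<le> i \<le> n-1
  (R even, so no Koszul signs occur)\<close>
definition rhoT :: "nat \<Rightarrow> (nat list \<Rightarrow> nat list \<Rightarrow> 'k::field) \<Rightarrow> nat
    \<Rightarrow> nat list \<Rightarrow> nat list \<Rightarrow> 'k" where
  "rhoT n R i w u =
     (if take (i - 1) w = take (i - 1) u \<and> drop (i + 1) w = drop (i + 1) u
      then R (take 2 (drop (i - 1) w)) (take 2 (drop (i - 1) u)) else 0)"

definition hecke_operator :: "nat \<Rightarrow> (nat \<Rightarrow> bool) \<Rightarrow> 'k::field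
    \<Rightarrow> (nat list \<Rightarrow> nat list \<Rightarrow> 'k) \<Rightarrow> bool" where
  "hecke_operator d p q R \<longleftrightarrow>
     (\<forall>w\<in>words d 2. \<forall>u\<in>words d 2. R w u \<noteq> 0 \<longrightarrow> wparity p w = wparity p u) \<and>
     (\<forall>w\<in>words d 2. \<forall>u\<in>words d 2.
        mat_mul d 2 (\<lambda>a b. R a b + mat_id a b) (\<lambda>a b. R a b - q * mat_id a b) w u = 0) \<and>
     (\<forall>w\<in>words d 3. \<forall>u\<in>words d 3.
        mat_mul d 3 (rhoT 3 R 1) (mat_mul d 3 (rhoT 3 R 2) (rhoT 3 R 1)) w u =
        mat_mul d 3 (rhoT 3 R 2) (mat_mul d 3 (rhoT 3 R 1) (rhoT 3 R 2)) w u)"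

definition qint :: "'k::field \<Rightarrow> nat \<Rightarrow> 'k" where
  "qint q n = (\<Sum>i<n. q ^ i)"

definition qfact :: "'k::field \<Rightarrow> nat \<Rightarrow> 'k" where
  "qfact q n = (\<Prod>i=1..n. qint q i)"

definition perm_of_word :: "nat list \<Rightarrow> nat \<Rightarrow> nat" where
  "perm_of_word ws = foldr (\<lambda>i acc. transpose i (Suc i) \<circ> acc) ws id"

definition reduced_expr :: "nat \<Rightarrow> nat list \<Rightarrow> (nat \<Rightarrow> nat) \<Rightarrow> bool" where
  "reduced_expr n ws \<sigma> \<longleftrightarrow>
     set ws \<subseteq> {1..<n} \<and> perm_of_word ws = \<sigma> \<and>
     (\<forall>ws'. set ws' \<subseteq> {1..<n} \<and> perm_of_word ws' = \<sigma> \<longrightarrow> length ws \<le> length ws')"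

definition rho_Tperm :: "nat \<Rightarrow> nat \<Rightarrow> (nat list \<Rightarrow> nat list \<Rightarrow> 'k::field)
    \<Rightarrow> (nat \<Rightarrow> nat) \<Rightarrow> nat list \<Rightarrow> nat list \<Rightarrow> 'k" where
  "rho_Tperm d n R \<sigma> =
     foldr (\<lambda>i M. mat_mul d n (rhoT n R i) M) (SOME ws. reduced_expr n ws \<sigma>) mat_id"

definition rho_qsym :: "nat \<Rightarrow> 'k::field \<Rightarrow> nat \<Rightarrow> (nat list \<Rightarrow> nat list \<Rightarrow> 'k)
    \<Rightarrow> nat list \<Rightarrow> nat list \<Rightarrow> 'k" where
  "rho_qsym d q n R w u =
     (1 / qfact q n) * (\<Sum>\<sigma>\<in>{\<sigma>. \<sigma> permutes {1..n}}. rho_Tperm d n R \<sigma> w u)"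

definition relspace :: "nat \<Rightarrow> 'k::field \<Rightarrow> nat \<Rightarrow> (nat list \<Rightarrow> nat list \<Rightarrow> 'k)
    \<Rightarrow> (nat list \<Rightarrow> 'k) set" where
  "relspace d q N R = mat_app d N (rho_qsym d q N R) ` tspace d N"

text \<open>
The algebra A = T(V)/(Rel), Rel \<subseteq> V^(tensor N).  Its degree-n part is
V^(tensor n) / I_n with I_n = sum over a+N+b=n of V^(tensor a) (x) Rel (x) V^(tensor b).
For a composition c = [m1,...,mi] of m (all mj \<ge> 1),
A_m1 (x) ... (x) A_mi = V^(tensor m) / J c, where J c is spanned by u (x) r (x) v
with the window of r inside a single block of c.
\<close>
definition compositions :: "nat \<Rightarrow> nat \<Rightarrow> nat list set" where
  "compositions m i = {c. length c = i \<and> (\<forall>j\<in>set c. 0 < j) \<and> sum_list c = m}"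

definition Jsub :: "nat \<Rightarrow> nat \<Rightarrow> (nat list \<Rightarrow> 'k::field) set \<Rightarrow> nat list
    \<Rightarrow> (nat list \<Rightarrow> 'k) set" where
  "Jsub d N Rel c = lspan {tens a u (tens N r v) | a b u r v.
      u \<in> tspace d a \<and> r \<in> Rel \<and> v \<in> tspace d b \<and> a + N + b = sum_list c \<and>
      (\<exists>j<length c. sum_list (take j c) \<le> a \<and> a + N \<le> sum_list (take (Suc j) c))}"

text \<open>
Normalized bar complex computing Tor^A(k,k): B_i = (A_+)^(tensor i), internal degree m.
An element of (B_i)_m is represented by a family x c \<in> V^(tensor m), c a composition
of m into i parts, modulo J c.  The differential multiplies adjacent factors,
which in this model merges adjacent blocks of the composition.
\<close>
definition bar_chains :: "nat \<Rightarrow> nat \<Rightarrow> nat \<Rightarrow> (nat list \<Rightarrow> nat list \<Rightarrow> 'k::field) set" where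
  "bar_chains d i m = {x. \<forall>c. (c \<notin> compositions m i \<longrightarrow> x c = (\<lambda>_. 0)) \<and> x c \<in> tspace d m}"

definition merge_blocks :: "nat \<Rightarrow> nat list \<Rightarrow> nat list" where
  "merge_blocks j c = take j c @ [c ! j + c ! Suc j] @ drop (Suc (Suc j)) c"

definition bar_diff :: "nat \<Rightarrow> nat \<Rightarrow> (nat list \<Rightarrow> nat list \<Rightarrow> 'k::field)
    \<Rightarrow> nat list \<Rightarrow> nat list \<Rightarrow> 'k" where
  "bar_diff m i x c' w =
     (\<Sum>j<i - 1. (-1) ^ (Suc j) *
        (\<Sum>c\<in>compositions m i. if merge_blocks j c = c' then x c w else 0))"

definition tor_vanishes :: "nat \<Rightarrow> nat \<Rightarrow> (nat list \<Rightarrow> 'k::field) set \<Rightarrow> nat \<Rightarrow> nat \<Rightarrow> bool" where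
  "tor_vanishes d N Rel i m \<longleftrightarrow>
     (\<forall>x\<in>bar_chains d i m.
        (\<forall>c\<in>compositions m (i - 1). bar_diff m i x c \<in> Jsub d N Rel c) \<longrightarrow>
        (\<exists>y\<in>bar_chains d (Suc i) m. \<forall>c\<in>compositions m i.
            (\<lambda>w. bar_diff m (Suc i) y c w - x c w) \<in> Jsub d N Rel c))"

definition nuN :: "nat \<Rightarrow> nat \<Rightarrow> nat" where
  "nuN N i = (if even i then (i div 2) * N else ((i - 1) div 2) * N + 1)"

definition N_Koszul :: "nat \<Rightarrow> nat \<Rightarrow> (nat list \<Rightarrow> 'k::field) set \<Rightarrow> bool" where
  "N_Koszul d N Rel \<longleftrightarrow> (\<forall>i m. m \<noteq> nuN N i \<longrightarrow> tor_vanishes d N Rel i m)"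

end

theory Submission
  imports Defs "HOL-Library.Function_Algebras"
begin

text \<open>
Since the q-integers are invertible, \<open>Rel\<close> is the common q-eigenspace of \<open>T_1, ..., T_(N-1)\<close>. Hence all
windows \<open>V^a (x) Rel (x) V^b\<close> in \<open>V^m\<close> are intersections of the eigenspaces \<open>E_i = ker (T_i - q)\<close>,
which do not depend on \<open>N\<close>. These eigenspaces generate a distributive lattice: if \<open>X\<close> and \<open>Y\<close> are the
symmetrizer and antisymmetrizer of neighbouring groups of \<open>a\<close> and \<open>b\<close> letters, and \<open>X'\<close> and \<open>Y'\<close> those of
the groups enlarged by one letter of the neighbour, then \<open>X Y\<close> is a combination of \<open>Y X' Y\<close> and \<open>X Y' X\<close>
(the contracting homotopy of the quadratic Koszul complex), which gives one distributivity relation for every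
number of generators in the intersection; the others follow by exchanging generators. Distributivity splits
\<open>V^m\<close> into a sum of pieces indexed by sets \<open>D\<close> of positions such that \<open>E_i\<close> is the sum of the pieces with
\<open>i\<close> in \<open>D\<close>. On each piece the bar complex becomes that of a monomial algebra whose relations are the
runs of \<open>N - 1\<close> positions in \<open>D\<close>, and its homology is computed by hand.
\<close>

section \<open>Hecke symmetrizers\<close>

text \<open>Why the combination of \<open>Y X' Y\<close> and \<open>X Y' X\<close> yields
  distributivity: \<open>Y'\<close> kills every \<open>E_i\<close> inside its group, because the
  dual generator acts on \<open>E_i\<close> as -1 while \<open>Y'\<close> absorbs it as q, and 1 + q
  is nonzero; and the image of 1 - \<open>Y\<close> lies in the sum of the \<open>E_i\<close> of the
  group of \<open>Y\<close>. For a vector in a sum of eigenspaces the second term therefore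
  disappears up to contributions from outside the group, and the first provides a correction that
  satisfies one eigencondition more. The weights come from [a + b] = [b] + q^b [a], with groups as
  long as \<open>m\<close> allows, so that q-integers beyond [N] have to be inverted. A separate
  obstacle is that \<open>T_\<sigma>\<close> is given by an arbitrary reduced expression. Each
  reduced word is compared with one normal word per permutation, a form of Matsumoto's theorem,
  before the image of the symmetrizer is identified. The degrees \<open>nuN\<close> arise because
  the compositions that survive in the monomial complex start with the blocks 1, N - 1: removing
  this pair lowers the homological degree by 2 and the internal degree by \<open>N\<close>.\<close>

lemma qint_Suc: "qint q (Suc n) = 1 + q * qint q n"
proof -
  have "qint q (Suc n) = (\<Sum>i<Suc n. q ^ i)" by (simp add: qint_def)
  also have "\<dots> = 1 + (\<Sum>i<n. q ^ Suc i)" by (subst sum.lessThan_Suc_shift) simp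
  finally show ?thesis by (simp add: qint_def sum_distrib_left)
qed

lemma qint_0 [simp]: "qint q 0 = 0" by (simp add: qint_def)
lemma qint_1 [simp]: "qint q (Suc 0) = 1" by (simp add: qint_def)

text \<open>Makes the two weights in \<open>hook\<close> add up to 1.\<close>

lemma qint_add: "qint q (a + b) = qint q b + q ^ b * qint q a"
  by (induction a) (auto simp: algebra_simps qint_def power_add)

lemma qint_minus_1: "(q - 1) * qint q b = q ^ b - 1"
  by (induction b) (auto simp: qint_def algebra_simps)

text \<open>\<open>n\<close> counts generators, so this is an action of the Hecke algebra on n + 1
  strands. All axioms on \<open>t\<close> are restricted to indices below \<open>n\<close>, so that
  a window of an action, read forwards or backwards, is again an instance (\<open>shift\<close>,
  \<open>reversed\<close>).\<close>

locale hecke_action = vector_space scale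
  for scale :: "'a::field \<Rightarrow> 'b::ab_group_add \<Rightarrow> 'b" (infixr \<open>*s\<close> 75) +
  fixes q :: 'a and t :: "nat \<Rightarrow> 'b \<Rightarrow> 'b" and n :: nat
  assumes t_add: "i < n \<Longrightarrow> t i (x + y) = t i x + t i y"
    and t_scale: "i < n \<Longrightarrow> t i (c *s x) = c *s t i x"
    and quad: "i < n \<Longrightarrow> t i (t i v) = (q - 1) *s t i v + q *s v"
    and braid: "Suc i < n \<Longrightarrow> t i (t (Suc i) (t i v)) = t (Suc i) (t i (t (Suc i) v))"
    and comm: "j < n \<Longrightarrow> Suc i < j \<Longrightarrow> t i (t j v) = t j (t i v)"
    and qint_nz: "qint q (Suc k) \<noteq> 0"
begin

text \<open>The normalized symmetrizer on k + 1 letters, by a recursion of the kind that Wenzl used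
  for the Jones-Wenzl idempotents. It adds one generator at a time and so needs neither reduced
  words nor lengths.\<close>

primrec X :: "nat \<Rightarrow> 'b \<Rightarrow> 'b" where
  "X 0 v = v"
| "X (Suc k) v =
     (1 / qint q (k + 2)) *s X k (X k v + qint q (k + 1) *s t k (X k v))"

lemma one_plus_q: "1 + q \<noteq> 0"
  using qint_nz[of 1] by (simp add: qint_Suc)

lemma X_add: "k \<le> n \<Longrightarrow> X k (u + v) = X k u + X k v"
proof (induction k arbitrary: u v)
  case (Suc k)
  then show ?case
    by (simp add: t_add scale_right_distrib add_ac)
qed simp

lemma X_scale: "k \<le> n \<Longrightarrow> X k (c *s v) = c *s X k v"
proof (induction k arbitrary: c v)
  case (Suc k)
  then have *: "k \<le> n" "k < n" by auto
  have "X k (c *s X k v + qint q (k + 1) *s (c *s t k (X k v)))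
        = c *s X k (X k v + qint q (k + 1) *s t k (X k v))"
  proof -
    have "X k (d *s w) = d *s X k w" for d w using * by (simp add: Suc.IH)
    then show ?thesis using * by (simp only: X_add) (simp add: scale_right_distrib mult.commute)
  qed
  then show ?case using * by (simp add: Suc.IH t_scale mult.commute)
qed simp

lemma X_commutes:
  assumes "k \<le> n" and g: "\<And>x y. g (x + y) = g x + g y" "\<And>c x. g (c *s x) = c *s g x"
    and "\<And>i v. i < k \<Longrightarrow> g (t i v) = t i (g v)"
  shows "g (X k v) = X k (g v)"
  using assms(1,4)
proof (induction k arbitrary: v)
  case (Suc k)
  then have IH: "\<And>v. g (X k v) = X k (g v)" by simp
  show ?case using Suc.prems by (simp add: IH g)
qed simp

lemma X_fix: "k \<le> n \<Longrightarrow> (\<And>i. i < k \<Longrightarrow> t i v = q *s v) \<Longrightarrow> X k v = v"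
proof (induction k)
  case (Suc k)
  then have *: "X k v = v" "t k v = q *s v" by auto
  have "v + qint q (k + 1) *s q *s v = qint q (k + 2) *s v"
    by (simp add: qint_Suc[of q "Suc k"] scale_left_distrib mult.commute)
  then have "X (Suc k) v = (1 / qint q (k + 2)) *s X k (qint q (k + 2) *s v)" using * by simp
  then show ?case using Suc.prems * qint_nz[of "Suc k"] by (simp add: X_scale)
qed simp

text \<open>In X (Suc k) the outer copies of \<open>X k\<close> absorb all generators but the new
  one, t k. To absorb that one, \<open>X k\<close> is unfolded once more, which exposes t (k - 1)
  and t k to the braid relation.\<close>

lemma X_left_right:
  "k \<le> n \<Longrightarrow> i < k \<Longrightarrow> t i (X k v) = q *s X k v \<and> X k (t i v) = q *s X k v"
proof (induction k arbitrary: i v)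
  case (Suc k)
  have kn: "k < n" "k \<le> n" using Suc.prems by auto
  have L: "t i (X k v) = q *s X k v" and Rr: "X k (t i v) = q *s X k v" if "i < k" for i v
    using Suc.IH[of i v] that kn by auto
  show ?case
  proof (cases "i = k")
    case False
    with Suc.prems have "i < k" by simp
    have "X k (X k (t i v)) = q *s X k (X k v)" "X k (t k (X k (t i v))) = q *s X k (t k (X k v))"
      using Rr[OF \<open>i < k\<close>] kn by (simp_all add: X_scale t_scale)
    with kn L[OF \<open>i < k\<close>] Suc.prems show ?thesis
      by (simp add: t_add t_scale X_add X_scale scale_right_distrib mult.commute)
  next
    case ik: True
    show ?thesis
    proof (cases k)
      case 0
      have "t 0 (v + t 0 v) = q *s (v + t 0 v)" "t 0 v + t 0 (t 0 v) = q *s (v + t 0 v)"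
        using kn 0 by (simp_all add: t_add quad scale_left_diff_distrib scale_right_distrib)
      with ik kn 0 show ?thesis by (simp add: t_scale mult.commute)
    next
      case (Suc j)
      define a where "a = qint q (Suc j)"
      define b where "b = qint q (Suc (Suc j))"
      have ba: "b = 1 + q * a" by (simp add: a_def b_def qint_Suc)
      have jn: "j < n" "j \<le> n" "Suc j < n" using kn Suc by auto
      let ?t = "t j" and ?u = "t (Suc j)"
      have XS: "X (Suc j) v = (1 / b) *s X j (X j v + a *s ?t (X j v))" for v
        by (simp add: a_def b_def numeral_2_eq_2)
      note X.simps(2) [simp del]
      have L: "t i (X (Suc j) v) = q *s X (Suc j) v" and Rr: "X (Suc j) (t i v) = q *s X (Suc j) v"
        if "i < Suc j" for i v using L Rr that Suc by auto
      have XjX: "X j (X (Suc j) v) = X (Suc j) v" for v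
        using X_fix[of "j" "X (Suc j) v"] L jn by simp
      have Xj_X: "X (Suc j) (X j v) = X (Suc j) v" for v
      proof -
        have aux: "l \<le> j \<Longrightarrow> X (Suc j) (X l v) = X (Suc j) v" for l v
        proof (induction l arbitrary: v)
          case (Suc l)
          have "X (Suc j) (X (Suc l) v) = (1 / qint q (l + 2)) *s
              (X (Suc j) (X l (X l v)) + qint q (l + 1) *s X (Suc j) (X l (t l (X l v))))"
            using Suc.prems jn by (simp add: X.simps(2)[of l] X_add X_scale)
          also have "\<dots> = (1 / qint q (l + 2)) *s
              (X (Suc j) v + qint q (l + 1) *s q *s X (Suc j) v)"
          proof -
            have "X (Suc j) (X l x) = X (Suc j) x" "X (Suc j) (t l x) = q *s X (Suc j) x" for x
              using Suc.prems by (simp_all only: Suc.IH Suc_leD Rr less_Suc_eq_le)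
            then show ?thesis by (simp only:)
          qed
          also have "\<dots> = (1 / qint q (l + 2)) *s (qint q (l + 2) *s X (Suc j) v)"
            by (simp add: qint_Suc[of q "Suc l"] scale_left_distrib mult.commute del: X.simps)
          finally show ?case using qint_nz[of "Suc l"] by (simp del: X.simps)
        qed simp
        then show ?thesis by simp
      qed
      have tX: "?u (X j v) = X j (?u v)" for v
        by (rule X_commutes) (use jn in \<open>auto simp: t_add t_scale comm[symmetric]\<close>)
      \<comment> \<open>Up to the factor 1 + q, \<open>?t (?u w)\<close> is 1 + \<open>?u\<close>
        applied to itself; hence it is a q-eigenvector of \<open>?u\<close> (see
        \<open>uP\<close>).\<close>
      have step: "(1 + q) *s ?t (?u w) = ?t (?u w) + ?u (?t (?u w))" if "?t w = q *s w" for w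
      proof -
        have "?t (?u (?t w)) = ?u (?t (?u w))" using braid[of j w] jn by simp
        then have "q *s ?t (?u w) = ?u (?t (?u w))" using that jn by (simp add: t_scale)
        then show ?thesis by (simp add: scale_left_distrib)
      qed
      have abs1: "?u (v + ?u v) = q *s (v + ?u v)" for v
        using jn by (simp add: t_add quad scale_left_diff_distrib scale_right_distrib)
      \<comment> \<open>This is (1 + a \<open>?t\<close>) (1 + b \<open>?u\<close>) on vectors with
        \<open>?t v = q *s v\<close>, where b = 1 + q a collects the first coefficient. Both
        summands are q-eigenvectors of \<open>?u\<close>.\<close>
      define P where "P v = b *s (v + ?u v) + (a * b) *s ?t (?u v)" for v
      have P1: "(v + b *s ?u v) + a *s ?t (v + b *s ?u v) = P v" if "?t v = q *s v" for v
        using jn that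
        by (simp add: P_def t_add t_scale scale_right_distrib ba scale_left_distrib algebra_simps)
      have uP: "?u (P v) = q *s P v" if "?t v = q *s v" for v
      proof -
        have "(1 + q) *s ?u (?t (?u v)) = ?u (?t (?u v) + ?u (?t (?u v)))"
          using step[OF that] jn by (metis t_scale)
        also have "\<dots> = q *s ((1 + q) *s ?t (?u v))" by (simp add: abs1 step[OF that])
        finally have "(1 + q) *s ?u (?t (?u v)) = (1 + q) *s (q *s ?t (?u v))"
          by (simp add: mult.commute)
        then have "?u (?t (?u v)) = q *s ?t (?u v)"
          using one_plus_q by (simp only: scale_cancel_left) simp
        moreover have "?u (P v) = b *s ?u (v + ?u v) + (a * b) *s ?u (?t (?u v))"
          using jn by (simp only: P_def t_add[of "Suc j" "b *s (v + ?u v)"] t_scale)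
        ultimately show ?thesis
          by (simp only: abs1) (simp add: P_def scale_right_distrib mult.commute)
      qed
      have XSS: "X (Suc (Suc j)) v = (1 / (qint q (j + 3) * b)) *s X j (P (X (Suc j) v))" for v
      proof -
        let ?w = "X (Suc j) v"
        have "X (Suc (Suc j)) v = (1 / qint q (j + 3)) *s X (Suc j) (?w + b *s ?u ?w)"
          by (simp add: X.simps(2)[of "Suc j"] b_def numeral_3_eq_3)
        also have "X (Suc j) (?w + b *s ?u ?w) = (1 / b) *s X j (P ?w)"
        proof -
          have "X j (?w + b *s ?u ?w) = ?w + b *s ?u ?w"
            using jn tX[of ?w, symmetric] by (simp only: X_add X_scale XjX)
          then show ?thesis using P1[OF L[of j v]] by (simp only: XS[of "?w + b *s ?u ?w"])
        qed
        finally show ?thesis by simp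
      qed
      have left: "?u (X (Suc (Suc j)) v) = q *s X (Suc (Suc j)) v"
        using uP[OF L[of j v]] jn by (simp only: XSS t_scale tX) (simp add: X_scale mult.commute)
      \<comment> \<open>For absorption from the right \<open>X (Suc j)\<close> stays outermost: the
        braid relation brings a \<open>?t\<close> to the front of the last summand, and
        \<open>X (Suc j)\<close> absorbs it.\<close>
      have XSS': "X (Suc (Suc j)) v = (1 / (qint q (j + 3) * b)) *s
          (b *s (X (Suc j) (X j v) + X (Suc j) (?u (X j v))) + (a * b) *s X (Suc j) (?u (?t (X j v))))" for v
      proof -
        let ?w = "X j v + a *s ?t (X j v)"
        have "X (Suc (Suc j)) v = (1 / qint q (j + 3)) *s X (Suc j) (X (Suc j) v + b *s ?u (X (Suc j) v))"
          by (simp add: X.simps(2)[of "Suc j"] b_def numeral_3_eq_3)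
        also have "X (Suc j) v + b *s ?u (X (Suc j) v) = (1 / b) *s (X j ?w + b *s X j (?u ?w))"
          using jn by (simp only: XS[of v] t_scale tX) (simp only: scale_right_distrib scale_scale mult.commute)
        also have "X (Suc j) ((1 / b) *s (X j ?w + b *s X j (?u ?w))) =
            (1 / b) *s (X (Suc j) (X j ?w) + b *s X (Suc j) (X j (?u ?w)))"
          using jn by (simp only: X_add X_scale)
        also have "\<dots> = (1 / b) *s (X (Suc j) ?w + b *s X (Suc j) (?u ?w))"
          by (simp only: Xj_X)
        also have "X (Suc j) ?w + b *s X (Suc j) (?u ?w) =
           b *s (X (Suc j) (X j v) + X (Suc j) (?u (X j v))) + (a * b) *s X (Suc j) (?u (?t (X j v)))"
          using jn by (simp only: X_add X_scale t_add t_scale Rr[of j] lessI)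
            (simp add: ba scale_left_distrib scale_right_distrib algebra_simps)
        finally show ?thesis by simp
      qed
      have right: "X (Suc (Suc j)) (?u v) = q *s X (Suc (Suc j)) v"
      proof -
        let ?Y = "X (Suc j)"
        have r1: "?Y x + ?Y (?u x) = ?Y (x + ?u x)" for x using jn by (simp add: X_add)
        have r2: "?u x + ?u (?u x) = q *s (x + ?u x)" for x using abs1[of x] jn by (simp add: t_add)
        have s: "?Y (?u (?t (?u x))) = q *s ?Y (?u (?t x))" for x
        proof -
          have "?Y (?u (?t (?u x))) = ?Y (?t (?u (?t x)))" using braid[of j x] jn by simp
          then show ?thesis by (simp only: Rr[of j] lessI)
        qed
        show ?thesis
          using jn by (simp only: XSS' tX[symmetric] s r1 r2 X_scale) (simp add: scale_right_distrib mult_ac)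
      qed
      show ?thesis using left right ik Suc by (simp only:)
    qed
  qed
qed simp

lemmas X_left = X_left_right[THEN conjunct1] and X_right = X_left_right[THEN conjunct2]

text \<open>Used for the dual action: there the spanning vectors are -(u + t i u), which are
  q-eigenvectors of the original generators.\<close>

lemma X_diff_span:
  "k \<le> n \<Longrightarrow> v - X k v \<in> span (\<Union>i<k. range (\<lambda>u. t i u - q *s u))"
proof (induction k arbitrary: v)
  case 0 then show ?case by (simp add: span_zero)
next
  case (Suc k)
  let ?S = "span (\<Union>i<Suc k. range (\<lambda>u. t i u - q *s u))"
  let ?b = "qint q (Suc k)" and ?c = "qint q (Suc (Suc k))"
  have kn: "k < n" "k \<le> n" using Suc.prems by auto
  have "(\<Union>i<k. range (\<lambda>u. t i u - q *s u)) \<subseteq> (\<Union>i<Suc k. range (\<lambda>u. t i u - q *s u))"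
    by (rule UN_mono) auto
  then have IH: "v - X k v \<in> ?S" for v
    using span_mono Suc.IH kn by blast
  define u where "u = X k v"
  define z where "z = u + ?b *s t k u"
  have 1: "t k u - q *s u \<in> ?S" by (rule span_base) auto
  have cc: "?c = 1 + ?b * q" by (simp add: qint_Suc[of q "Suc k"])
  have "z - ?c *s u = ?b *s (t k u - q *s u)"
    by (simp add: z_def cc scale_left_distrib scale_right_diff_distrib)
  with 1 have 2: "z - ?c *s u \<in> ?S" by (metis span_scale)
  have "X k z - ?c *s v = (z - ?c *s u) - (z - X k z) - ?c *s (v - u)"
    by (simp add: scale_right_diff_distrib)
  also have "\<dots> \<in> ?S"
    by (rule span_diff[OF span_diff[OF 2 IH] span_scale]) (simp only: u_def IH)
  finally have "(-1 / ?c) *s (X k z - ?c *s v) \<in> ?S" by (rule span_scale)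
  also have "(-1 / ?c) *s (X k z - ?c *s v) = v - X (Suc k) v"
    using qint_nz[of "Suc k"] by (simp add: z_def u_def scale_right_diff_distrib)
  finally show ?case .
qed

lemma X_invariant:
  assumes "k \<le> n" "subspace L" "\<And>i x. i < k \<Longrightarrow> x \<in> L \<Longrightarrow> t i x \<in> L" "v \<in> L"
  shows "X k v \<in> L"
  using assms(1,3,4)
proof (induction k arbitrary: v)
  case (Suc k)
  then have IH: "\<And>w. w \<in> L \<Longrightarrow> X k w \<in> L" by simp
  have "X k v + qint q (k + 1) *s t k (X k v) \<in> L"
    using Suc.prems assms(2) by (simp add: IH subspace_scale subspace_add)
  from IH[OF this] show ?case using assms(2) by (simp add: subspace_scale)
qed simp

lemma shift: "s + k \<le> n \<Longrightarrow> hecke_action scale q (\<lambda>i. t (s + i)) k"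
  by unfold_locales (auto simp: t_add t_scale quad braid comm qint_nz)

text \<open>The recursion for \<open>X\<close> adds the generator with the largest index. Counting
  down from \<open>e\<close> makes a group grow at its lower end instead, as the antisymmetrizer in
  \<open>hook\<close> must.\<close>

lemma reversed: "k \<le> e \<Longrightarrow> e \<le> n \<Longrightarrow> hecke_action scale q (\<lambda>i. t (e - Suc i)) k"
proof unfold_locales
  fix i v assume "k \<le> e" "e \<le> n" "Suc i < k"
  then show "t (e - Suc i) (t (e - Suc (Suc i)) (t (e - Suc i) v)) =
    t (e - Suc (Suc i)) (t (e - Suc i) (t (e - Suc (Suc i)) v))"
    using braid[of "e - Suc (Suc i)" v] by (simp add: Suc_diff_Suc)
next
  fix i j v assume "k \<le> e" "e \<le> n" "Suc i < j" "j < k"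
  then show "t (e - Suc i) (t (e - Suc j) v) = t (e - Suc j) (t (e - Suc i) v)"
    using comm[of "e - Suc i" "e - Suc j" v] by auto
qed (auto simp: t_add t_scale quad qint_nz)

text \<open>The substitution of \<open>q - 1 - T = -q T^(-1)\<close> for \<open>T\<close> turns symmetrizers into antisymmetrizers.\<close>
lemma dual: "hecke_action scale q (\<lambda>i v. (q - 1) *s v - t i v) n"
proof -
  have t_diff: "t i (x - y) = t i x - t i y" if "i < n" for i x y
    using t_add[OF that, of "x - y" y] by (simp add: algebra_simps)
  show ?thesis
  proof (unfold_locales, goal_cases)
    case (4 i v)
    then have i: "i < n" by simp
    then show ?case using braid[OF 4, of v]
      by (simp add: t_add[OF i] t_add[OF 4] t_diff[OF i] t_diff[OF 4] t_scale[OF i] t_scale[OF 4]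
            quad[OF i] quad[OF 4] algebra_simps)
  qed (auto simp: t_diff t_add t_scale quad comm qint_nz algebra_simps)
qed

text \<open>The generators s, ..., r - 1 act on the group where \<open>v\<close> is symmetric, those
  after r on the group to be antisymmetrized, and t r links the two. The eigencondition for
  \<open>r\<close> is moved from the sum into \<open>w\<close>. \<open>L\<close> takes up the
  eigenspaces beyond the window, and the last clause transfers to \<open>w\<close> the
  eigenconditions of \<open>v\<close> for operators that commute with the window.\<close>

lemma hook:
  assumes "s \<le> r" "r < e" "e \<le> n"
    and v: "\<And>i. s \<le> i \<Longrightarrow> i < r \<Longrightarrow> t i v = q *s v"
    and L: "subspace L" "\<And>i x. s \<le> i \<Longrightarrow> i < e \<Longrightarrow> x \<in> L \<Longrightarrow> t i x \<in> L"
    and vE: "v \<in> span ((\<Union>i\<in>{r..<e}. {x. t i x = q *s x}) \<union> L)"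
  obtains w where "\<And>i. s \<le> i \<Longrightarrow> i \<le> r \<Longrightarrow> t i w = q *s w"
    and "v - w \<in> span ((\<Union>i\<in>{Suc r..<e}. {x. t i x = q *s x}) \<union> L)"
    and "\<And>g. \<lbrakk>\<And>x y. g (x + y) = g x + g y; \<And>c x. g (c *s x) = c *s g x;
              \<And>i x. s \<le> i \<Longrightarrow> i < e \<Longrightarrow> g (t i x) = t i (g x); g v = q *s v\<rbrakk> \<Longrightarrow> g w = q *s w"
proof -
  \<comment> \<open>The two groups have a + 1 and b + 1 letters; adding t r to either gives the
    idempotents with index \<open>Suc a\<close> and \<open>Suc b\<close>.\<close>
  define a b where "a = r - s" and "b = e - Suc r"
  interpret X: hecke_action scale q "\<lambda>i. t (s + i)" "Suc a"
    using assms by (intro shift) (simp add: a_def)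
  interpret R: hecke_action scale q "\<lambda>i. t (e - Suc i)" "Suc b"
    using assms by (intro reversed) (auto simp: b_def)
  interpret Y: hecke_action scale q "\<lambda>i v. (q - 1) *s v - t (e - Suc i) v" "Suc b"
    by (rule R.dual)
  define A B c where "A = qint q (Suc a)" and "B = qint q (Suc b)" and "c = qint q (Suc (Suc (a + b)))"
  have cnz: "c \<noteq> 0" by (simp add: c_def qint_nz)
  have r: "s + a = r" "e - Suc b = r" using assms by (auto simp: a_def b_def)
  let ?X = "X.X a" and ?Y = "Y.X b"
  have com_y: "g ((q - 1) *s x - t (e - Suc i) x) = (q - 1) *s g x - t (e - Suc i) (g x)"
    if g: "\<And>x y. g (x + y) = g x + g y" "\<And>c x. g (c *s x) = c *s g x"
      and "\<And>x. g (t (e - Suc i) x) = t (e - Suc i) (g x)" for g i x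
  proof -
    have "g (x - y) = g x - g y" for x y using g(1)[of "x - y" y] by (simp add: algebra_simps)
    then show ?thesis by (simp add: that)
  qed
  have XY: "?X (?Y x) = ?Y (?X x)" for x
  proof (rule Y.X_commutes)
    fix i v assume "i < b"
    then have "r < e - Suc i" "e - Suc i < e" using assms by (auto simp: b_def)
    then have "?X (t (e - Suc i) x) = t (e - Suc i) (?X x)" for x
      by (intro X.X_commutes[symmetric]) (use r assms in \<open>auto simp: t_add t_scale comm[symmetric]\<close>)
    then show "?X ((q - 1) *s v - t (e - Suc i) v) = (q - 1) *s ?X v - t (e - Suc i) (?X v)"
      by (intro com_y) (auto simp: X.X_add X.X_scale)
  qed (auto simp: X.X_add X.X_scale)
  define u where "u = ?Y v"
  have Xv: "?X v = v" by (rule X.X_fix) (use r v in auto)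
  have Xu: "?X u = u" by (simp add: u_def XY Xv)
  have YY: "?Y (?Y x) = ?Y x" for x by (rule Y.X_fix) (auto simp: Y.X_left)
  have Yu: "?Y u = u" by (simp add: u_def YY)
  \<comment> \<open>The only term besides \<open>u\<close> in both Y X' u and X Y' v, with opposite
    signs.\<close>
  define z where "z = ?X (?Y (t r u))"
  have YX': "?Y (X.X (Suc a) u) = (1 / qint q (Suc (Suc a))) *s (u + A *s z)"
    by (simp add: r A_def z_def Xu Yu X.X_add X.X_scale Y.X_add Y.X_scale XY)
  have XY': "?X (Y.X (Suc b) v) = (1 / qint q (Suc (Suc b))) *s ((q ^ Suc b) *s u - B *s z)"
  proof -
    have "Y.X (Suc b) v = (1 / qint q (Suc (Suc b))) *s ?Y (u + B *s ((q - 1) *s u - t r u))"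
      by (simp add: r B_def u_def)
    also have "u + B *s ((q - 1) *s u - t r u) = (1 + (q - 1) * B) *s u + (- B) *s t r u"
      by (simp add: scale_right_diff_distrib scale_left_distrib mult.commute)
    also have "1 + (q - 1) * B = q ^ Suc b" by (simp only: B_def qint_minus_1) simp
    finally show ?thesis
      by (simp only: X.X_add X.X_scale Y.X_add Y.X_scale Xu Yu z_def le_SucI[OF le_refl]) simp
  qed
  \<comment> \<open>The weights cancel \<open>z\<close>; what remains is (B + q^(b+1) A) / c times
    \<open>u\<close>, which is \<open>u\<close> by \<open>qint_add\<close>.\<close>
  have comb: "(B * qint q (Suc (Suc a)) / c) *s ?Y (X.X (Suc a) u)
      + (A * qint q (Suc (Suc b)) / c) *s ?X (Y.X (Suc b) v) = u"
  proof -
    have "c = B + q ^ Suc b * A"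
      using qint_add[of q "Suc a" "Suc b"] by (simp add: c_def A_def B_def)
    moreover have "B / c + A / c * q ^ Suc b = (B + q ^ Suc b * A) / c"
      by (simp add: add_divide_distrib mult.commute)
    ultimately have "B / c + A / c * q ^ Suc b = 1" using cnz by simp
    then have *: "(B / c) *s u + (A / c * q ^ Suc b) *s u = u"
      by (metis scale_left_distrib scale_one)
    have "B * qint q (Suc (Suc a)) / c * (1 / qint q (Suc (Suc a))) = B / c"
      using qint_nz[of "Suc a"] by simp
    then have "(B * qint q (Suc (Suc a)) / c) *s ?Y (X.X (Suc a) u) = (B / c) *s u + (B / c * A) *s z"
      by (simp only: YX' scale_scale scale_right_distrib mult.assoc[symmetric])
    moreover have "A * qint q (Suc (Suc b)) / c * (1 / qint q (Suc (Suc b))) = A / c"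
      using qint_nz[of "Suc b"] by simp
    then have "(A * qint q (Suc (Suc b)) / c) *s ?X (Y.X (Suc b) v)
        = (A / c * q ^ Suc b) *s u - (A / c * B) *s z"
      by (simp only: XY' scale_scale scale_right_diff_distrib mult.assoc[symmetric])
    moreover have "A / c * B = B / c * A" by simp
    moreover have "x + y + (z - y) = x + z" for x y z :: 'b by simp
    ultimately show ?thesis using * by (simp only:)
  qed
  define w where "w = (B * qint q (Suc (Suc a)) / c) *s X.X (Suc a) u"
  have 1: "t i w = q *s w" if "s \<le> i" "i \<le> r" for i
    using X.X_left[of "Suc a" "i - s" u] that assms r
    by (simp add: w_def t_scale mult.commute del: X.X.simps)
  have invL: "(q - 1) *s x - t (e - Suc i) x \<in> L" if "i < Suc b" "x \<in> L" for i x
    using that assms r by (intro subspace_diff subspace_scale) (auto simp: b_def)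
  \<comment> \<open>A q-eigenvector x of one of the generators is killed: the dual generator sends
    it to -x, but the antisymmetrizer absorbs that generator as q. Only the part of \<open>v\<close>
    in \<open>L\<close> survives.\<close>
  have "Y.X (Suc b) v \<in> L"
  proof -
    have "subspace {x. Y.X (Suc b) x \<in> L}"
    proof (rule subspaceI)
      show "0 \<in> {x. Y.X (Suc b) x \<in> L}"
        using Y.X_scale[of "Suc b" 0 0] subspace_0[OF L(1)] by (simp del: Y.X.simps)
    qed (simp_all only: mem_Collect_eq Y.X_add Y.X_scale le_refl subspace_add[OF L(1)] subspace_scale[OF L(1)])
    moreover have "(\<Union>i\<in>{r..<e}. {x. t i x = q *s x}) \<union> L \<subseteq> {x. Y.X (Suc b) x \<in> L}"
    proof safe
      fix x assume "x \<in> L" then show "Y.X (Suc b) x \<in> L"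
        using Y.X_invariant[OF le_refl L(1) invL] by simp
    next
      fix i x assume i: "i \<in> {r..<e}" and x: "t i x = q *s x"
      define j where "j = e - Suc i"
      have j: "j < Suc b" "e - Suc j = i" using i r assms by (auto simp: j_def b_def)
      have "Y.X (Suc b) ((q - 1) *s x - t i x) = q *s Y.X (Suc b) x"
        using Y.X_right[OF le_refl j(1), of x] j(2) by simp
      moreover have "(q - 1) *s x - t i x = (- 1) *s x" by (simp add: x scale_left_diff_distrib)
      ultimately have "q *s Y.X (Suc b) x = - Y.X (Suc b) x"
        by (simp only: Y.X_scale[OF le_refl]) (simp del: Y.X.simps)
      then have "(1 + q) *s Y.X (Suc b) x = 0" by (simp add: scale_left_distrib del: Y.X.simps)
      then have "Y.X (Suc b) x = 0" using one_plus_q by (simp only: scale_eq_0_iff) simp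
      then show "Y.X (Suc b) x \<in> L" using L(1) by (simp only: subspace_0)
    qed
    ultimately show ?thesis using vE span_minimal by blast
  qed
  then have XL: "?X (Y.X (Suc b) v) \<in> L"
    by (rule X.X_invariant[rotated 3]) (use L r assms in auto)
  let ?S = "span ((\<Union>i\<in>{Suc r..<e}. {x. t i x = q *s x}) \<union> L)"
  have "?Y (v - w) \<in> L"
  proof -
    have eq: "x = z" if "x + y = c" "y + z = c" for x y z c :: 'b
      using that by (metis add.commute add_left_cancel)
    have "?Y (v - w) + ?Y w = u"
      using Y.X_add[of b "v - w" w] by (simp only: diff_add_cancel u_def le_SucI[OF le_refl])
    moreover have "?Y w = (B * qint q (Suc (Suc a)) / c) *s ?Y (X.X (Suc a) u)"
      unfolding w_def by (rule Y.X_scale) simp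
    note trans[OF arg_cong[OF this, of "\<lambda>x. x + (A * qint q (Suc (Suc b)) / c) *s ?X (Y.X (Suc b) v)"] comb]
    ultimately have "?Y (v - w) = (A * qint q (Suc (Suc b)) / c) *s ?X (Y.X (Suc b) v)"
      by (rule eq)
    then show ?thesis by (rule ssubst) (rule subspace_scale[OF L(1) XL])
  qed
  then have Y_S: "?Y (v - w) \<in> ?S" by (intro span_base) auto
  have "(v - w) - ?Y (v - w) \<in> ?S"
  proof -
    have "(\<Union>i<b. range (\<lambda>x. (q - 1) *s x - t (e - Suc i) x - q *s x))
        \<subseteq> (\<Union>i\<in>{Suc r..<e}. {x. t i x = q *s x}) \<union> L"
    proof (rule subsetI, elim UN_E rangeE)
      fix y i x assume y: "y = (q - 1) *s x - t (e - Suc i) x - q *s x" and "i \<in> {..<b}"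
      then have i: "e - Suc i \<in> {Suc r..<e}" "e - Suc i < n" using assms by (auto simp: b_def)
      let ?i = "e - Suc i"
      have "t ?i ((- 1) *s (x + t ?i x)) = q *s ((- 1) *s (x + t ?i x))"
        using i by (simp only: t_scale t_add quad) (simp add: scale_left_diff_distrib scale_right_diff_distrib)
      moreover have "(q - 1) *s x - t ?i x - q *s x = (- 1) *s (x + t ?i x)"
        by (simp add: algebra_simps)
      ultimately have "(q - 1) *s x - t ?i x - q *s x \<in> {x. t ?i x = q *s x}" by (simp only: mem_Collect_eq)
      with i y show "y \<in> (\<Union>i\<in>{Suc r..<e}. {x. t i x = q *s x}) \<union> L" by blast
    qed
    from span_mono[OF this] show ?thesis using Y.X_diff_span[of b "v - w"] by auto
  qed
  from span_add[OF this Y_S] have 2: "v - w \<in> ?S" by (simp only: diff_add_cancel)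
  have 3: "g w = q *s w"
    if g: "\<And>x y. g (x + y) = g x + g y" "\<And>c x. g (c *s x) = c *s g x"
      and gt: "\<And>i x. s \<le> i \<Longrightarrow> i < e \<Longrightarrow> g (t i x) = t i (g x)" and gv: "g v = q *s v" for g
  proof -
    have "g u = ?Y (g v)" unfolding u_def
      by (rule Y.X_commutes) (use g gt assms in \<open>auto intro!: com_y simp: b_def\<close>)
    then have gu: "g u = q *s u" by (simp add: gv Y.X_scale u_def)
    have "g (X.X (Suc a) u) = X.X (Suc a) (g u)"
      by (rule X.X_commutes) (use g gt r assms in auto)
    then have "g (X.X (Suc a) u) = q *s X.X (Suc a) u" by (simp only: gu X.X_scale[OF le_refl])
    then show ?thesis by (simp only: w_def g) (simp only: scale_scale mult.commute)
  qed
  show thesis by (rule that[of w]) (fact 1, fact 2, rule 3)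
qed

end

section \<open>Distributivity\<close>

context vector_space begin

lemma complement_in_subspace:
  assumes "subspace N" "subspace M" "N \<subseteq> M"
  obtains C where "subspace C" "C \<subseteq> M" "C \<inter> N = {0}" "\<And>v. v \<in> M \<Longrightarrow> \<exists>x\<in>N. \<exists>y\<in>C. v = x + y"
proof -
  obtain B0 where B0: "B0 \<subseteq> N" "independent B0" "N \<subseteq> span B0"
    using maximal_independent_subset[of N] by blast
  have N: "span B0 = N" using B0 assms(1) span_minimal by blast
  obtain B where B: "B0 \<subseteq> B" "B \<subseteq> M" "independent B" "M \<subseteq> span B"
    using maximal_independent_subset_extend[of B0 M] B0 assms(3) by blast
  show thesis
  proof (rule that[of "span (B - B0)"])
    show "subspace (span (B - B0))" by simp
    show "span (B - B0) \<subseteq> M" using B assms(2) by (intro span_minimal) auto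
    show "span (B - B0) \<inter> N = {0}"
    proof safe
      fix x assume x: "x \<in> span (B - B0)" "x \<in> N"
      have "representation B0 x = representation B x"
        using B x N by (intro representation_extend[symmetric]) auto
      moreover have "representation (B - B0) x = representation B x"
        using B x by (intro representation_extend[symmetric]) auto
      ultimately have "representation B x b = 0" for b
        using representation_ne_zero[of B0 x b] representation_ne_zero[of "B - B0" x b] by auto
      then show "x = 0"
        using sum_nonzero_representation_eq[of B x] B x by (simp add: span_mono subset_iff)
          (metis B(4) assms(3) subset_iff)
    qed (use assms in \<open>auto simp: subspace_0 span_zero\<close>)
    show "\<exists>x\<in>N. \<exists>y\<in>span (B - B0). v = x + y" if "v \<in> M" for v
    proof -
      have "v \<in> span (B0 \<union> (B - B0))" using that B by (simp add: Un_absorb1 subset_iff)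
      then show ?thesis unfolding span_Un N by blast
    qed
  qed
qed

end

locale subspace_family = vector_space scale
  for scale :: "'a::field \<Rightarrow> 'b::ab_group_add \<Rightarrow> 'b" (infixr \<open>*s\<close> 75) +
  fixes E :: "'i \<Rightarrow> 'b set"
  assumes subspace_E: "subspace (E i)"
begin

definition meet :: "'i set \<Rightarrow> 'b set" where "meet J = (\<Inter>i\<in>J. E i)"

definition join :: "'i set \<Rightarrow> 'b set" where "join K = span (\<Union>i\<in>K. E i)"

text \<open>The opposite inclusion always holds. The instances with \<open>K\<close> complementary
  to \<open>J\<close> suffice to split the whole space compatibly with all
  \<open>E i\<close>.\<close>

definition distributes :: "'i set \<Rightarrow> 'i set \<Rightarrow> bool" where
  "distributes J K \<longleftrightarrow> meet J \<inter> join K \<subseteq> span (\<Union>i\<in>K. meet (insert i J))"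

lemma subspace_meet: "subspace (meet J)"
  unfolding meet_def by (rule subspace_Inter) (auto simp: subspace_E)

lemma span_meet [simp]: "span (meet J) = meet J"
  by (simp add: subspace_meet span_eq_iff)

lemma meet_insert: "meet (insert i J) = E i \<inter> meet J"
  by (auto simp: meet_def)

lemma meet_mono: "J \<subseteq> J' \<Longrightarrow> meet J' \<subseteq> meet J"
  by (auto simp: meet_def)

lemma subspace_join: "subspace (join K)"
  by (simp add: join_def)

lemma E_join: "i \<in> K \<Longrightarrow> E i \<subseteq> join K"
  unfolding join_def by (rule order_trans[OF _ span_superset]) auto

lemma join_mono: "K \<subseteq> K' \<Longrightarrow> join K \<subseteq> join K'"
  unfolding join_def by (intro span_mono UN_mono) auto

lemma span_meets_join: "span (\<Union>i\<in>K. meet (insert i J)) \<subseteq> join K"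
  unfolding join_def by (intro span_mono UN_mono) (auto simp: meet_insert)

lemma span_UN_insert:
  assumes "x \<in> span (\<Union>i\<in>insert k K. meet (insert i J))"
  obtains y z where "x = y + z" "y \<in> meet (insert k J)" "z \<in> span (\<Union>i\<in>K. meet (insert i J))"
  using assms by (auto simp: span_Un)

text \<open>Split \<open>v\<close> by the first hypothesis. Its part in the meet with
  \<open>k\<close> is a difference of two vectors of \<open>join (insert j B)\<close>, so the third
  hypothesis splits it again; removing the piece in both \<open>E j\<close> and \<open>E k\<close>
  leaves a vector for the second. The first two hypotheses involve fewer indices, the third the same
  indices with \<open>j\<close> and \<open>k\<close> exchanged.\<close>

lemma distributes_swap:
  assumes 1: "distributes A (insert k B)" and 2: "distributes (insert j A) B"
    and 3: "distributes (insert k A) (insert j B)"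
  shows "distributes (insert j A) (insert k B)"
  unfolding distributes_def
proof
  fix v assume "v \<in> meet (insert j A) \<inter> join (insert k B)"
  then have v: "v \<in> E j" "v \<in> meet A" "v \<in> join (insert k B)" by (auto simp: meet_insert)
  then have "v \<in> span (\<Union>i\<in>insert k B. meet (insert i A))"
    using 1 by (auto simp: distributes_def)
  then obtain y z where yz: "v = y + z" "y \<in> meet (insert k A)" "z \<in> span (\<Union>i\<in>B. meet (insert i A))"
    by (rule span_UN_insert)
  have z: "z \<in> join B" using yz(3) span_meets_join by blast
  have "v \<in> join (insert j B)" using v E_join by blast
  moreover have "z \<in> join (insert j B)" using z join_mono by blast
  ultimately have "v - z \<in> join (insert j B)" by (rule subspace_diff[OF subspace_join])
  with yz 3 have "y \<in> span (\<Union>i\<in>insert j B. meet (insert i (insert k A)))"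
    by (auto simp: distributes_def)
  then obtain y1 y2 where y: "y = y1 + y2" "y1 \<in> meet (insert j (insert k A))"
      "y2 \<in> span (\<Union>i\<in>B. meet (insert i (insert k A)))"
    by (rule span_UN_insert)
  have y2: "y2 \<in> join B" using y(3) span_meets_join by blast
  have eq: "v - y1 = y2 + z" using y yz by simp
  have "v - y1 \<in> meet (insert j A)"
    using v y(2) by (intro subspace_diff[OF subspace_meet]) (auto simp: meet_insert)
  moreover have "v - y1 \<in> join B"
    unfolding eq using y2 z by (intro subspace_add[OF subspace_join])
  ultimately have "v - y1 \<in> span (\<Union>i\<in>B. meet (insert i (insert j A)))"
    using 2 by (auto simp: distributes_def)
  then have "v - y1 \<in> span (\<Union>i\<in>insert k B. meet (insert i (insert j A)))"
    by (rule subsetD[OF span_mono, rotated]) auto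
  moreover have "y1 \<in> span (\<Union>i\<in>insert k B. meet (insert i (insert j A)))"
    using y(2) by (intro span_base) (auto simp: meet_insert)
  ultimately show "v \<in> span (\<Union>i\<in>insert k B. meet (insert i (insert j A)))"
    using span_add by fastforce
qed

text \<open>Choosing complements to the part of \<open>meet D\<close> lying in larger meets splits the whole space.\<close>
lemma simultaneous_decomposition:
  assumes I: "finite I" and dist: "\<And>J. J \<subseteq> I \<Longrightarrow> distributes J (I - J)"
  obtains \<pi> :: "'i set \<Rightarrow> 'b \<Rightarrow> 'b" where
    "\<And>D x y. \<pi> D (x + y) = \<pi> D x + \<pi> D y" "\<And>D c x. \<pi> D (c *s x) = c *s \<pi> D x"
    "\<And>v. (\<Sum>D\<in>Pow I. \<pi> D v) = v" "\<And>D v. D \<subseteq> I \<Longrightarrow> \<pi> D v \<in> meet D"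
    "\<And>D i v. D \<subseteq> I \<Longrightarrow> i \<in> I - D \<Longrightarrow> v \<in> E i \<Longrightarrow> \<pi> D v = 0"
    "\<And>D D' v. D \<subseteq> I \<Longrightarrow> \<pi> D' (\<pi> D v) = (if D' = D then \<pi> D v else 0)"
proof -
  define N where "N J = span (\<Union>i\<in>I - J. meet (insert i J))" for J
  have "\<exists>C. subspace C \<and> C \<subseteq> meet J \<and> C \<inter> N J = {0} \<and> (\<forall>v\<in>meet J. \<exists>x\<in>N J. \<exists>y\<in>C. v = x + y)" for J
  proof -
    have "N J \<subseteq> meet J" unfolding N_def
      by (rule span_minimal[OF _ subspace_meet]) (auto simp: meet_insert)
    then show ?thesis using complement_in_subspace[of "N J" "meet J"]
      by (metis N_def subspace_meet subspace_span)
  qed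
  then obtain C where C: "\<And>J. subspace (C J)" "\<And>J. C J \<subseteq> meet J" "\<And>J. C J \<inter> N J = {0}"
      "\<And>J v. v \<in> meet J \<Longrightarrow> \<exists>x\<in>N J. \<exists>y\<in>C J. v = x + y" by metis
  \<comment> \<open>Vanishing off the subsets of \<open>I\<close> makes a family determined by its
    sum over \<open>Pow I\<close>, so linearity of the projections follows from uniqueness.\<close>
  define fam where "fam f \<longleftrightarrow> (\<forall>D. f D \<in> C D) \<and> (\<forall>D. \<not> D \<subseteq> I \<longrightarrow> f D = 0)" for f
  have C0: "0 \<in> C D" for D using C(1) by (rule subspace_0)
  define R where "R J = {v. \<exists>f. fam f \<and> (\<forall>D. \<not> J \<subseteq> D \<longrightarrow> f D = 0) \<and> v = (\<Sum>D\<in>Pow I. f D)}" for J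
  have subR: "subspace (R J)" for J
  proof (rule subspaceI)
    show "0 \<in> R J" unfolding R_def fam_def using C0 by (auto intro!: exI[of _ "\<lambda>_. 0"])
  next
    fix x y assume "x \<in> R J" "y \<in> R J"
    then obtain f g where "fam f" "fam g" "\<And>D. \<not> J \<subseteq> D \<Longrightarrow> f D = 0" "\<And>D. \<not> J \<subseteq> D \<Longrightarrow> g D = 0"
      "x = (\<Sum>D\<in>Pow I. f D)" "y = (\<Sum>D\<in>Pow I. g D)" unfolding R_def by blast
    then show "x + y \<in> R J" unfolding R_def fam_def
      using C(1) by (intro CollectI exI[of _ "\<lambda>D. f D + g D"] conjI allI impI)
        (simp_all add: sum.distrib subspace_add)
  next
    fix c x assume "x \<in> R J"
    then obtain f where "fam f" "\<And>D. \<not> J \<subseteq> D \<Longrightarrow> f D = 0"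
      "x = (\<Sum>D\<in>Pow I. f D)" unfolding R_def by blast
    then show "c *s x \<in> R J" unfolding R_def fam_def
      using C(1) by (intro CollectI exI[of _ "\<lambda>D. c *s f D"] conjI allI impI)
        (simp_all add: scale_sum_right subspace_scale)
  qed
  \<comment> \<open>Induction downwards from J = I: \<open>N J\<close> is spanned by meets over
    larger sets, and \<open>C J\<close> supplies the rest.\<close>
  have meetR: "J \<subseteq> I \<Longrightarrow> meet J \<subseteq> R J" for J
  proof (induction "card (I - J)" arbitrary: J rule: less_induct)
    case (less J)
    have CR: "C J \<subseteq> R J"
    proof
      fix c assume c: "c \<in> C J"
      have "(\<Sum>D\<in>Pow I. if D = J then c else 0) = c" using less.prems I by simp
      with c C0 less.prems show "c \<in> R J" unfolding R_def fam_def
        by (intro CollectI exI[of _ "\<lambda>D. if D = J then c else 0"]) auto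
    qed
    have "N J \<subseteq> R J" unfolding N_def
    proof (rule span_minimal[OF _ subR], rule UN_least)
      fix i assume i: "i \<in> I - J"
      then have "card (I - insert i J) < card (I - J)" using I by (intro psubset_card_mono) auto
      then have "meet (insert i J) \<subseteq> R (insert i J)" using less i by auto
      also have "\<dots> \<subseteq> R J" unfolding R_def by blast
      finally show "meet (insert i J) \<subseteq> R J" .
    qed
    with CR show ?case using C(4)[of _ J] subspace_add[OF subR] by blast
  qed
  have unique0: "f D = 0" if f: "fam f" "(\<Sum>D\<in>Pow I. f D) = 0" for f D
  proof (rule ccontr)
    assume D: "f D \<noteq> 0"
    \<comment> \<open>With \<open>D\<close> of least size, every other member of the support has an
      index outside \<open>D\<close> and lies in \<open>join (I - D)\<close>. So does
      \<open>f D\<close>; distributivity puts it into \<open>N D\<close>, which meets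
      \<open>C D\<close> only in 0.\<close>
    obtain D where D: "f D \<noteq> 0" and min: "\<And>D'. f D' \<noteq> 0 \<Longrightarrow> card D \<le> card D'"
      using ex_has_least_nat[of "\<lambda>D. f D \<noteq> 0" D card] D by blast
    have DI: "D \<subseteq> I" using f D by (auto simp: fam_def)
    have "f D' \<in> join (I - D)" if D': "D' \<in> Pow I - {D}" for D'
    proof (cases "f D' = 0")
      case True then show ?thesis by (simp add: subspace_0 subspace_join)
    next
      case False
      have "finite D" using DI I by (rule finite_subset)
      then have "\<not> D' \<subset> D" using min[OF False] psubset_card_mono[of D D'] by linarith
      then obtain i where i: "i \<in> D'" "i \<notin> D" using D' by blast
      have "f D' \<in> meet D'" using f C(2) by (auto simp: fam_def)
      then have "f D' \<in> E i" using i by (auto simp: meet_def)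
      then show ?thesis using E_join[of i "I - D"] i D' by auto
    qed
    then have "(\<Sum>D'\<in>Pow I - {D}. f D') \<in> join (I - D)"
      by (rule subspace_sum[OF subspace_join])
    moreover have "f D + (\<Sum>D'\<in>Pow I - {D}. f D') = 0"
      using f(2) DI I by (simp add: sum.remove)
    ultimately have "f D \<in> join (I - D)"
      by (simp add: eq_neg_iff_add_eq_0[symmetric] subspace_neg[OF subspace_join])
    moreover have "f D \<in> C D" using f by (auto simp: fam_def)
    ultimately have "f D \<in> C D \<inter> N D"
      using dist[OF DI] C(2) unfolding distributes_def N_def by blast
    with C(3) D show False by blast
  qed
  have unique: "f = g" if "fam f" "fam g" "(\<Sum>D\<in>Pow I. f D) = (\<Sum>D\<in>Pow I. g D)" for f g
  proof
    fix D
    have "fam (\<lambda>D. f D - g D)" using that C(1) by (auto simp: fam_def subspace_diff)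
    from unique0[OF this] that have "f D - g D = 0" by (simp add: sum_subtractf)
    then show "f D = g D" by simp
  qed
  have "\<exists>f. fam f \<and> (\<Sum>D\<in>Pow I. f D) = v" for v
  proof -
    have "v \<in> R {}" using meetR[of "{}"] by (auto simp: meet_def)
    then show ?thesis unfolding R_def by blast
  qed
  then obtain F where F: "\<And>v. fam (F v)" "\<And>v. (\<Sum>D\<in>Pow I. F v D) = v" by metis
  show thesis
  proof (rule that[of "\<lambda>D v. F v D"])
    fix D :: "'i set" and x y c
    have "F (x + y) = (\<lambda>D. F x D + F y D)"
      using C(1) F by (intro unique) (auto simp: sum.distrib fam_def subspace_add)
    then show "F (x + y) D = F x D + F y D" by simp
    have "F (c *s x) = (\<lambda>D. c *s F x D)"
      using C(1) F by (intro unique) (auto simp: scale_sum_right[symmetric] fam_def subspace_scale)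
    then show "F (c *s x) D = c *s F x D" by simp
  next
    fix v show "(\<Sum>D\<in>Pow I. F v D) = v" by (rule F)
  next
    fix D v show "F v D \<in> meet D" using F(1)[of v] C(2) by (auto simp: fam_def)
  next
    fix D i v assume i: "D \<subseteq> I" "i \<in> I - D" "v \<in> E i"
    then have "v \<in> R {i}" using meetR[of "{i}"] by (auto simp: meet_def)
    then obtain f where f: "fam f" "\<And>D. i \<notin> D \<Longrightarrow> f D = 0" "v = (\<Sum>D\<in>Pow I. f D)"
      unfolding R_def by auto
    have "F v = f" using f F by (intro unique) auto
    with f i show "F v D = 0" by auto
  next
    fix D D' v assume D: "D \<subseteq> I"
    have "F (F v D) = (\<lambda>D'. if D' = D then F v D else 0)"
    proof (rule unique[OF F(1)])
      show "fam (\<lambda>D'. if D' = D then F v D else 0)"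
        using F(1)[of v] C0 D by (auto simp: fam_def)
      show "sum (F (F v D)) (Pow I) = (\<Sum>D'\<in>Pow I. if D' = D then F v D else 0)"
        using I D by (simp add: F(2))
    qed
    then show "F (F v D) D' = (if D' = D then F v D else 0)" by simp
  qed
qed

end

locale nat_subspace_family = subspace_family scale E
  for scale :: "'a::field \<Rightarrow> 'b::ab_group_add \<Rightarrow> 'b" and E :: "nat \<Rightarrow> 'b set"
begin

text \<open>Induction on the number of indices and, for a fixed union, on the sum of
  \<open>J\<close>. Exchanging a pair k < j with j in \<open>J\<close> and k in \<open>K\<close>
  lowers that sum; if there is no such pair, all of \<open>J\<close> lies below \<open>K\<close> and
  \<open>initial\<close> applies.\<close>

lemma distributes_all:
  assumes I: "finite I"
    and initial: "\<And>J K. \<lbrakk>J \<subseteq> I; K \<subseteq> I; K \<noteq> {}; \<And>j k. j \<in> J \<Longrightarrow> k \<in> K \<Longrightarrow> j < k; distributes J (K - {Min K})\<rbrakk>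
      \<Longrightarrow> distributes J K"
  shows "J \<subseteq> I \<Longrightarrow> K \<subseteq> I \<Longrightarrow> J \<inter> K = {} \<Longrightarrow> distributes J K"
proof (induction "card (J \<union> K)" arbitrary: J K rule: less_induct)
  case outer: less
  show ?case using outer.prems outer.hyps
  proof (induction "\<Sum>J" arbitrary: J K rule: less_induct)
    case (less J K)
    have fin: "finite J" "finite K" using less.prems I by (auto intro: finite_subset)
    have IH: "distributes J' K'" if "J' \<union> K' \<subset> J \<union> K" "J' \<inter> K' = {}" for J' K'
    proof (rule less.prems(4))
      show "card (J' \<union> K') < card (J \<union> K)" using that fin by (intro psubset_card_mono) auto
      have "J' \<union> K' \<subseteq> I" using that(1) less.prems(1,2) by blast
      then show "J' \<subseteq> I" "K' \<subseteq> I" by auto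
    qed fact
    show ?case
    proof (cases "\<exists>j\<in>J. \<exists>k\<in>K. k < j")
      case True
      then obtain j k where jk: "j \<in> J" "k \<in> K" "k < j" by blast
      define A B where "A = J - {j}" and "B = K - {k}"
      have J: "J = insert j A" "j \<notin> A" and K: "K = insert k B" "k \<notin> B" using jk by (auto simp: A_def B_def)
      have fAB: "finite A" "finite B" using fin by (auto simp: A_def B_def)
      have kA: "k \<notin> A" "j \<notin> B" using jk less.prems by (auto simp: A_def B_def)
      have un: "insert k A \<union> insert j B = J \<union> K" using J K by auto
      have "\<Sum>(insert k A) < \<Sum>J" using J kA jk fAB by simp
      moreover have "insert k A \<subseteq> I" "insert j B \<subseteq> I" using less.prems(1,2) J K by auto
      moreover have "insert k A \<inter> insert j B = {}" using less.prems(3) J K kA jk by auto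
      moreover note less.prems(4)[folded un]
      ultimately have "distributes (insert k A) (insert j B)"
        by (rule less.hyps)
      moreover have "distributes A (insert k B)"
      proof (rule IH)
        have "j \<notin> A \<union> insert k B" "j \<in> J \<union> K" using J kA jk by auto
        then show "A \<union> insert k B \<subset> J \<union> K" unfolding J K by blast
      qed (use less.prems(3) J K kA jk in auto)
      moreover have "distributes (insert j A) B"
      proof (rule IH)
        have "k \<notin> insert j A \<union> B" "k \<in> J \<union> K" using K kA jk by auto
        then show "insert j A \<union> B \<subset> J \<union> K" unfolding J K by blast
      qed (use less.prems(3) J K kA jk in auto)
      ultimately show ?thesis unfolding J(1) K(1) by (rule distributes_swap[rotated 2])
    next
      case False
      show ?thesis
      proof (cases "K = {}")
        case True then show ?thesis by (simp add: distributes_def join_def)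
      next
        case K: False
        then have "Min K \<in> K" using fin by simp
        then have "distributes J (K - {Min K})"
          using less.prems(3) by (intro IH) blast+
        moreover have "j < k" if "j \<in> J" "k \<in> K" for j k
          using that False less.prems(3) by (metis disjoint_iff linorder_neqE_nat)
        ultimately show ?thesis using initial[of J K] less.prems(1,2) K by blast
      qed
    qed
  qed
qed

end

section \<open>Distributivity of the eigenspaces of a Hecke action\<close>

context hecke_action begin

text \<open>The whole space for \<open>i \<ge> n\<close>, where \<open>t i\<close> is not assumed
  linear; thus every member of the family is a subspace.\<close>

definition eig :: "nat \<Rightarrow> 'b set" where
  "eig i = {x. i < n \<longrightarrow> t i x = q *s x}"

sublocale nat_subspace_family scale eig
proof
  fix i show "subspace (eig i)"
  proof (cases "i < n")
    case True
    then have "t i 0 = 0" using t_scale[of i 0 0] by simp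
    with True show ?thesis
      by (auto intro!: subspaceI simp: eig_def t_add t_scale scale_right_distrib mult.commute)
  qed (simp add: eig_def)
qed

lemma t_span_invariant:
  assumes "i < n" "\<And>x. x \<in> S \<Longrightarrow> t i x \<in> S" "x \<in> span S"
  shows "t i x \<in> span S"
proof -
  have "t i 0 = 0" using t_scale[of i 0 0] assms(1) by simp
  then have "subspace {x. t i x \<in> span S}"
    using assms(1) by (auto intro!: subspaceI simp: t_add t_scale span_add span_scale span_zero)
  moreover have "S \<subseteq> {x. t i x \<in> span S}" using assms(2) by (auto intro: span_base)
  ultimately show ?thesis using span_minimal assms(3) by blast
qed

text \<open>The window for \<open>hook\<close> consists of the longest run of \<open>J\<close>
  ending just below r = Min K and the longest run of \<open>K\<close> starting at r. The rest of
  \<open>J\<close> and the rest of \<open>K\<close> are separated from it by gaps and so commute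
  with its generators. What \<open>hook\<close> leaves over has lost \<open>r\<close> and is covered
  by the assumption on \<open>K - {Min K}\<close>.\<close>

lemma distributes_initial:
  assumes J: "J \<subseteq> {..<n}" and K: "K \<subseteq> {..<n}" "K \<noteq> {}"
    and JK: "\<And>j k. j \<in> J \<Longrightarrow> k \<in> K \<Longrightarrow> j < k" and dist: "distributes J (K - {Min K})"
  shows "distributes J K"
  unfolding distributes_def
proof
  fix v assume "v \<in> meet J \<inter> join K"
  then have vJ: "v \<in> meet J" and vK: "v \<in> join K" by auto
  define r where "r = Min K"
  have finK: "finite K" using K by (auto intro: finite_subset)
  have r: "r \<in> K" "\<And>k. k \<in> K \<Longrightarrow> r \<le> k" using finK K(2) by (auto simp: r_def)
  have rn: "r < n" using r K by auto
  define s where "s = (LEAST s. {s..<r} \<subseteq> J)"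
  have s: "{s..<r} \<subseteq> J" unfolding s_def by (rule LeastI[of _ r]) simp
  have sr: "s \<le> r" unfolding s_def by (rule Least_le) simp
  \<comment> \<open>So the indices of \<open>J\<close> below \<open>s\<close> differ by at least 2
    from all indices of the window.\<close>
  have s_gap: "i \<notin> J" if "Suc i = s" for i
  proof
    assume "i \<in> J"
    then have "{i..<r} \<subseteq> J" using s that by (metis atLeastLessThan_iff le_neq_implies_less not_less_eq_eq subset_iff Suc_leI)
    then have "s \<le> i" unfolding s_def by (rule Least_le)
    with that show False by simp
  qed
  define e where "e = (LEAST e. r < e \<and> e \<notin> K)"
  have "r < n \<and> n \<notin> K" using rn K by auto
  then have e: "r < e" "e \<notin> K" "e \<le> n" unfolding e_def
    using LeastI[of "\<lambda>e. r < e \<and> e \<notin> K" n] Least_le[of "\<lambda>e. r < e \<and> e \<notin> K" n] by auto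
  have eK: "{r..<e} \<subseteq> K"
  proof
    fix i assume i: "i \<in> {r..<e}"
    then have "\<not> (r < i \<and> i \<notin> K)" unfolding e_def using not_less_Least by auto
    with i r show "i \<in> K" by (cases "i = r") auto
  qed
  define L where "L = join (K - {r..<e})"
  have inv: "t i x \<in> L" if i: "s \<le> i" "i < e" and x: "x \<in> L" for i x
  proof -
    have "t i y \<in> (\<Union>k\<in>K - {r..<e}. eig k)" if y: "y \<in> (\<Union>k\<in>K - {r..<e}. eig k)" for y
    proof -
      obtain k where k: "k \<in> K - {r..<e}" "y \<in> eig k" using y by blast
      \<comment> \<open>As \<open>e\<close> is not in \<open>K\<close>, k exceeds every i < e by at
        least 2, so t k and t i commute.\<close>
      then have "k \<noteq> e" "e \<le> k" "k < n" using e r K by auto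
      then have "t k (t i y) = t i (t k y)" "i < n" using i comm[of k i y] by auto
      then have "t i y \<in> eig k" using k(2) \<open>k < n\<close> by (simp add: eig_def t_scale)
      with k show ?thesis by blast
    qed
    with i e x show ?thesis unfolding L_def join_def by (intro t_span_invariant) auto
  qed
  have vi: "t i v = q *s v" if "s \<le> i" "i < r" for i
  proof -
    have "i \<in> J" using that s by auto
    then show ?thesis using vJ J by (auto simp: meet_def eig_def)
  qed
  have eigs: "(\<Union>i\<in>{a..<e}. eig i) = (\<Union>i\<in>{a..<e}. {x. t i x = q *s x})" for a
    using e by (auto simp: eig_def)
  have "v \<in> span ((\<Union>i\<in>{r..<e}. eig i) \<union> L)"
  proof -
    have "(\<Union>i\<in>K. eig i) \<subseteq> (\<Union>i\<in>{r..<e}. eig i) \<union> L"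
    proof (rule UN_least)
      fix i assume "i \<in> K"
      then show "eig i \<subseteq> (\<Union>i\<in>{r..<e}. eig i) \<union> L"
        using E_join[of i "K - {r..<e}"] unfolding L_def by (cases "i \<in> {r..<e}") blast+
    qed
    from span_mono[OF this] show ?thesis using vK by (auto simp: join_def)
  qed
  then have vspan: "v \<in> span ((\<Union>i\<in>{r..<e}. {x. t i x = q *s x}) \<union> L)" by (simp only: eigs)
  obtain w where w: "\<And>i. s \<le> i \<Longrightarrow> i \<le> r \<Longrightarrow> t i w = q *s w"
    and vw: "v - w \<in> span ((\<Union>i\<in>{Suc r..<e}. {x. t i x = q *s x}) \<union> L)"
    and gw: "\<And>g. \<lbrakk>\<And>x y. g (x + y) = g x + g y; \<And>c x. g (c *s x) = c *s g x;
              \<And>i x. s \<le> i \<Longrightarrow> i < e \<Longrightarrow> g (t i x) = t i (g x); g v = q *s v\<rbrakk> \<Longrightarrow> g w = q *s w"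
    using hook[OF sr e(1,3) vi _ inv vspan] subspace_join[of "K - {r..<e}"] unfolding L_def by blast
  have wJ: "w \<in> meet (insert r J)"
    unfolding meet_def
  proof
    fix i assume i: "i \<in> insert r J"
    then have "i < n" using J rn by auto
    show "w \<in> eig i"
    proof (cases "s \<le> i")
      case True
      have "i \<le> r" using i JK[OF _ r(1)] by (auto intro: less_imp_le)
      with True w show ?thesis by (simp add: eig_def)
    next
      case False
      with i sr have "i \<in> J" by auto
      with False s_gap have "Suc i < s" by (metis Suc_lessI not_le)
      have "t i v = q *s v" using vJ \<open>i \<in> J\<close> \<open>i < n\<close> by (auto simp: meet_def eig_def)
      then have "t i w = q *s w"
        using \<open>i < n\<close> \<open>Suc i < s\<close> e(3) by (intro gw) (auto simp: t_add t_scale intro!: comm)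
      then show ?thesis by (simp add: eig_def)
    qed
  qed
  have "(\<Union>i\<in>{Suc r..<e}. eig i) \<union> L \<subseteq> join (K - {r})"
  proof (rule Un_least)
    show "L \<subseteq> join (K - {r})" unfolding L_def using e(1) by (intro join_mono) auto
    show "(\<Union>i\<in>{Suc r..<e}. eig i) \<subseteq> join (K - {r})" using eK by (intro UN_least E_join) auto
  qed
  then have "v - w \<in> join (K - {r})"
    using vw span_minimal[OF _ subspace_join] unfolding eigs[symmetric] by blast
  moreover have "v - w \<in> meet J"
    using vJ wJ meet_mono[of J "insert r J"] by (intro subspace_diff subspace_meet) auto
  ultimately have "v - w \<in> span (\<Union>i\<in>K - {r}. meet (insert i J))"
    using dist by (auto simp: distributes_def r_def)
  then have "v - w \<in> span (\<Union>i\<in>K. meet (insert i J))"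
    by (rule subsetD[OF span_mono, rotated]) auto
  moreover have "w \<in> span (\<Union>i\<in>K. meet (insert i J))"
    using wJ r by (intro span_base) auto
  ultimately show "v \<in> span (\<Union>i\<in>K. meet (insert i J))"
    using span_add[of "v - w" _ w] by simp
qed

lemma distributes_eig: "J \<subseteq> {..<n} \<Longrightarrow> K \<subseteq> {..<n} \<Longrightarrow> J \<inter> K = {} \<Longrightarrow> distributes J K"
  by (rule distributes_all[of "{..<n}"]) (auto intro: distributes_initial)

end

section \<open>Bar complexes of monomial type\<close>

text \<open>The bar differential read at a target composition: merging two adjacent blocks yields
  \<open>c\<close> exactly from the ways of splitting one block of \<open>c\<close>. Recursion on
  the first block produces the alternating signs without index arithmetic.\<close>

fun bd :: "(nat list \<Rightarrow> 'a::ab_group_add) \<Rightarrow> nat list \<Rightarrow> 'a" where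
  "bd \<xi> [] = 0"
| "bd \<xi> (b # c) = - (\<Sum>x=1..<b. \<xi> (x # (b - x) # c)) - bd (\<lambda>r. \<xi> (b # r)) c"

lemma bd_zero [simp]: "bd (\<lambda>_. 0) c = 0"
  by (induction c) auto

lemma bd_minus: "bd (\<lambda>c. - \<xi> c) c = - bd \<xi> c"
  by (induction c arbitrary: \<xi>) (auto simp: sum_negf)

lemma bd_add: "bd (\<lambda>c. \<xi> c + \<eta> c) c = bd \<xi> c + bd \<eta> c"
  by (induction c arbitrary: \<xi> \<eta>) (auto simp: sum.distrib)

lemma bd_diff: "bd (\<lambda>c. \<xi> c - \<eta> c) c = bd \<xi> c - bd \<eta> c"
  by (induction c arbitrary: \<xi> \<eta>) (auto simp: sum_subtractf)

lemma bd_sum: "bd (\<lambda>c. \<Sum>x\<in>A. \<xi> x c) c = (\<Sum>x\<in>A. bd (\<xi> x) c)"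
  by (induction A rule: infinite_finite_induct) (auto simp: bd_add)

text \<open>A block is cut into three by cutting twice, the second cut hitting either the left or
  the right part. These are the terms that cancel in \<open>bd_bd\<close>.\<close>

lemma triple_sum_swap:
  fixes f :: "nat \<Rightarrow> nat \<Rightarrow> nat \<Rightarrow> 'a::comm_monoid_add"
  shows "(\<Sum>x=1..<b. \<Sum>y=1..<x. f y (x - y) (b - x)) = (\<Sum>x=1..<b. \<Sum>y=1..<b - x. f x y (b - x - y))"
proof -
  have "(\<Sum>x=1..<b. \<Sum>y=1..<x. f y (x - y) (b - x)) =
     (\<Sum>(x, y)\<in>Sigma {1..<b} (\<lambda>x. {1..<x}). f y (x - y) (b - x))"
    by (simp add: sum.Sigma)
  also have "\<dots> = (\<Sum>(x, y)\<in>Sigma {1..<b} (\<lambda>x. {1..<b - x}). f x y (b - x - y))"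
    by (rule sum.reindex_bij_witness[of _ "\<lambda>(x, y). (x + y, x)" "\<lambda>(x, y). (y, x - y)"]) auto
  also have "\<dots> = (\<Sum>x=1..<b. \<Sum>y=1..<b - x. f x y (b - x - y))"
    by (simp add: sum.Sigma)
  finally show ?thesis .
qed

lemma bd_bd [simp]: "bd (bd \<xi>) c = 0"
proof (induction c arbitrary: \<xi>)
  case (Cons b c)
  have IH: "bd (bd \<xi>) c = 0" for \<xi> :: "nat list \<Rightarrow> 'a" by (rule Cons.IH)
  have "bd (bd \<xi>) (b # c) =
      - (\<Sum>x=1..<b. - (\<Sum>y=1..<x. \<xi> (y # (x - y) # (b - x) # c))
          + (\<Sum>y=1..<b - x. \<xi> (x # y # (b - x - y) # c)) + bd (\<lambda>r. \<xi> (x # (b - x) # r)) c)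
      - (- (\<Sum>x=1..<b. bd (\<lambda>r. \<xi> (x # (b - x) # r)) c) - bd (bd (\<lambda>r. \<xi> (b # r))) c)"
    by (simp add: bd_diff bd_minus bd_sum algebra_simps)
  also have "\<dots> = 0"
    using triple_sum_swap[of "\<lambda>u v w. \<xi> (u # v # w # c)" b] by (simp add: IH sum.distrib sum_negf sum_subtractf)
  finally show ?case .
qed simp

text \<open>The window condition of \<open>Jsub\<close>, isolated so that it can be unfolded block
  by block.\<close>

definition in_block :: "nat \<Rightarrow> nat list \<Rightarrow> nat \<Rightarrow> bool" where
  "in_block N c a \<longleftrightarrow> (\<exists>j<length c. sum_list (take j c) \<le> a \<and> a + N \<le> sum_list (take (Suc j) c))"

lemma in_block_Nil [simp]: "\<not> in_block N [] a"
  by (simp add: in_block_def)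

lemma in_block_Cons: "in_block N (b # c) a \<longleftrightarrow> a + N \<le> b \<or> b \<le> a \<and> in_block N c (a - b)"
proof
  assume "in_block N (b # c) a"
  then obtain j where j: "j < Suc (length c)" "sum_list (take j (b # c)) \<le> a"
      "a + N \<le> sum_list (take (Suc j) (b # c))" by (auto simp: in_block_def)
  show "a + N \<le> b \<or> b \<le> a \<and> in_block N c (a - b)"
  proof (cases j)
    case (Suc i)
    with j have "i < length c \<and> sum_list (take i c) \<le> a - b \<and> a - b + N \<le> sum_list (take (Suc i) c)" "b \<le> a"
      by auto
    then show ?thesis unfolding in_block_def by blast
  qed (use j in auto)
next
  assume "a + N \<le> b \<or> b \<le> a \<and> in_block N c (a - b)"
  then show "in_block N (b # c) a"
  proof
    assume "a + N \<le> b"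
    then show ?thesis unfolding in_block_def by (intro exI[of _ 0]) auto
  next
    assume *: "b \<le> a \<and> in_block N c (a - b)"
    then obtain i where "i < length c" "sum_list (take i c) \<le> a - b" "a - b + N \<le> sum_list (take (Suc i) c)"
      by (auto simp: in_block_def)
    with * show ?thesis unfolding in_block_def by (intro exI[of _ "Suc i"]) auto
  qed
qed

text \<open>The positions between adjacent letters are numbered from 0; \<open>alive N D c\<close> says that no run of
  \<open>N - 1\<close> consecutive positions inside a block of \<open>c\<close> is contained in \<open>D\<close>.\<close>
definition alive :: "nat \<Rightarrow> nat set \<Rightarrow> nat list \<Rightarrow> bool" where
  "alive N D c \<longleftrightarrow> (\<forall>a. in_block N c a \<longrightarrow> \<not> {a..<a + N - 1} \<subseteq> D)"

lemma alive_Nil [simp]: "alive N D []" by (simp add: alive_def)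

text \<open>Position b - 1 sits at the cut after the first block and belongs to no block; the
  positions from b on are renumbered from 0 for the tail.\<close>

lemma alive_Cons:
  assumes "N \<ge> 1"
  shows "alive N D (b # c) \<longleftrightarrow>
    (\<forall>a. a + N \<le> b \<longrightarrow> \<not> {a..<a + N - 1} \<subseteq> D) \<and> alive N {i. i + b \<in> D} c"
proof -
  have sub: "{a..<a + N - 1} \<subseteq> {i. i + b \<in> D} \<longleftrightarrow> {a + b..<a + b + N - 1} \<subseteq> D" for a
  proof
    assume *: "{a..<a + N - 1} \<subseteq> {i. i + b \<in> D}"
    show "{a + b..<a + b + N - 1} \<subseteq> D"
    proof
      fix i assume "i \<in> {a + b..<a + b + N - 1}"
      then have "i - b \<in> {a..<a + N - 1}" "i - b + b = i" by auto
      with * show "i \<in> D" by (metis mem_Collect_eq subsetD)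
    qed
  next
    assume *: "{a + b..<a + b + N - 1} \<subseteq> D"
    show "{a..<a + N - 1} \<subseteq> {i. i + b \<in> D}"
    proof
      fix i assume "i \<in> {a..<a + N - 1}"
      then have "i + b \<in> {a + b..<a + b + N - 1}" by auto
      with * show "i \<in> {i. i + b \<in> D}" by blast
    qed
  qed
  show ?thesis unfolding alive_def in_block_Cons sub by (metis add_diff_cancel_right' le_add2 le_add_diff_inverse2)
qed

lemma alive_small:
  assumes "N \<ge> 1" "b < N"
  shows "alive N D (b # c) \<longleftrightarrow> alive N {i. i + b \<in> D} c"
  using assms by (auto simp: alive_Cons)

lemma alive_split:
  assumes "N \<ge> 1" "alive N D ((x + y) # c)"
  shows "alive N D (x # y # c)"
proof -
  have *: "\<not> {a..<a + N - 1} \<subseteq> D" if "a + N \<le> x + y" for a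
    using assms that by (auto simp: alive_Cons)
  have "\<not> {a..<a + N - 1} \<subseteq> {i. i + x \<in> D}" if "a + N \<le> y" for a
  proof
    assume **: "{a..<a + N - 1} \<subseteq> {i. i + x \<in> D}"
    have "{a + x..<a + x + N - 1} \<subseteq> D"
    proof
      fix i assume "i \<in> {a + x..<a + x + N - 1}"
      then have "i - x \<in> {a..<a + N - 1}" "i - x + x = i" by auto
      with ** show "i \<in> D" by (metis mem_Collect_eq subsetD)
    qed
    with *[of "a + x"] that show False by auto
  qed
  moreover have "{i. i + y \<in> {i. i + x \<in> D}} = {i. i + (x + y) \<in> D}" by (auto simp: algebra_simps)
  ultimately show ?thesis using assms * by (simp add: alive_Cons)
qed

text \<open>The only new windows are those that straddle the cut at \<open>x\<close>, and
  \<open>cross\<close> excludes them.\<close>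

lemma alive_merge:
  assumes N: "N \<ge> 1" and c: "alive N D (x # y # c)"
    and cross: "\<And>a. a < x \<Longrightarrow> x < a + N \<Longrightarrow> a + N \<le> x + y \<Longrightarrow> \<not> {a..<a + N - 1} \<subseteq> D"
  shows "alive N D ((x + y) # c)"
proof -
  have "\<not> {a..<a + N - 1} \<subseteq> D" if a: "a + N \<le> x + y" for a
  proof (cases "a + N \<le> x")
    case True then show ?thesis using c N by (auto simp: alive_Cons)
  next
    case False
    show ?thesis
    proof (cases "a < x")
      case True then show ?thesis using cross a False by auto
    next
      case False
      then have "a - x + N \<le> y" using a by auto
      moreover have "\<forall>a. a + N \<le> y \<longrightarrow> \<not> {a..<a + N - 1} \<subseteq> {i. i + x \<in> D}"
        using c unfolding alive_Cons[OF N] by blast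
      ultimately have "\<not> {a - x..<a - x + N - 1} \<subseteq> {i. i + x \<in> D}" by blast
      then obtain i where "i \<in> {a - x..<a - x + N - 1}" "i + x \<notin> D" by blast
      then have "i + x \<in> {a..<a + N - 1}" using False by auto
      with \<open>i + x \<notin> D\<close> show ?thesis by blast
    qed
  qed
  moreover have "{i. i + y \<in> {i. i + x \<in> D}} = {i. i + (x + y) \<in> D}" by (auto simp: algebra_simps)
  ultimately show ?thesis using c N by (simp add: alive_Cons)
qed

lemma nuN_add_2: "nuN N (Suc (Suc i)) = N + nuN N i"
  by (auto simp: nuN_def elim!: oddE)

text \<open>Chains are cleared from the left: subtracting boundaries and using the cycle condition confines
  them to compositions starting with the blocks 1, N - 1.\<close>
lemma alive_exact:
  fixes \<xi> :: "nat list \<Rightarrow> 'a::ab_group_add"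
  assumes N: "N \<ge> 2"
  shows "m \<noteq> nuN N i \<Longrightarrow>
    (\<And>c. Suc (length c) = i \<Longrightarrow> 0 \<notin> set c \<Longrightarrow> sum_list c = m \<Longrightarrow> alive N D c \<Longrightarrow> bd \<xi> c = 0) \<Longrightarrow>
    \<exists>\<eta>. \<forall>c. length c = i \<longrightarrow> 0 \<notin> set c \<longrightarrow> sum_list c = m \<longrightarrow> alive N D c \<longrightarrow> bd \<eta> c = \<xi> c"
proof (induction i arbitrary: m D \<xi> rule: less_induct)
  case (less i)
  have N1: "N \<ge> 1" using N by simp
  \<comment> \<open>Splitting off a leading 1. The sign makes \<open>bd \<eta>1\<close> agree with
    \<open>\<xi>\<close> wherever the first block is at least 2.\<close>
  define \<eta>1 :: "nat list \<Rightarrow> 'a" where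
    "\<eta>1 c = (case c of a # b # r \<Rightarrow> if a = 1 then - \<xi> ((1 + b) # r) else 0 | _ \<Rightarrow> 0)" for c
  have \<eta>1_Cons: "\<eta>1 (a # b # r) = (if a = 1 then - \<xi> ((1 + b) # r) else 0)" for a b r by (simp add: \<eta>1_def)
  have \<eta>1_ne: "\<eta>1 (a # r) = 0" if "a \<noteq> 1" for a r using that by (auto simp: \<eta>1_def split: list.splits)
  define \<xi>1 where "\<xi>1 c = \<xi> c - bd \<eta>1 c" for c
  have \<xi>1_ge2: "\<xi>1 (a # r) = 0" if "a \<ge> 2" for a r
  proof -
    have "(\<Sum>x=1..<a. \<eta>1 (x # (a - x) # r)) = (\<Sum>x\<in>{1}. \<eta>1 (x # (a - x) # r))"
      using that by (intro sum.mono_neutral_right) (auto simp: \<eta>1_ne)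
    then show ?thesis using that by (simp add: \<xi>1_def \<eta>1_Cons \<eta>1_ne)
  qed
  have cyc1: "bd \<xi>1 c = 0" if "Suc (length c) = i" "0 \<notin> set c" "sum_list c = m" "alive N D c" for c
    unfolding \<xi>1_def bd_diff using less.prems(2)[OF that] by simp
  \<comment> \<open>The cycle condition at the merged composition: every other splitting has a first
    block of at least 2, where \<open>\<xi>1\<close> vanishes.\<close>
  have \<xi>1_merge: "\<xi>1 (1 # b # r) = 0"
    if "length r + 2 = i" "0 \<notin> set r" "b \<noteq> 0" "sum_list r + Suc b = m" "alive N D ((1 + b) # r)" for b r
  proof -
    have "bd \<xi>1 ((1 + b) # r) = 0" using that by (intro cyc1) auto
    moreover have "(\<Sum>x=1..<1 + b. \<xi>1 (x # (1 + b - x) # r)) = (\<Sum>x\<in>{1}. \<xi>1 (x # (1 + b - x) # r))"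
      using that by (intro sum.mono_neutral_right) (auto intro!: \<xi>1_ge2)
    moreover have "\<xi>1 ((1 + b) # c) = 0" for c using that by (intro \<xi>1_ge2) auto
    ultimately show ?thesis by simp
  qed
  consider "i = 0" | "i = 1" | "i \<ge> 2" "\<not> {0..<N - 1} \<subseteq> D" | "i \<ge> 2" "{0..<N - 1} \<subseteq> D"
    by linarith
  then show ?case
  proof cases
    case 1
    with less.prems show ?thesis by (auto simp: nuN_def)
  next
    case 2
    have "bd \<eta>1 c = \<xi> c" if "length c = i" "0 \<notin> set c" "sum_list c = m" for c
    proof -
      from that 2 have c: "c = [m]" by (auto simp: length_Suc_conv)
      with that 2 less.prems(1) have "m \<ge> 2" by (auto simp: nuN_def)
      then have "\<xi>1 c = 0" unfolding c by (rule \<xi>1_ge2)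
      then show ?thesis unfolding \<xi>1_def by (metis eq_iff_diff_eq_0)
    qed
    then show ?thesis by blast
  next
    case 3
    \<comment> \<open>A window crossing the cut after a leading 1 starts at 0, and in this case its
      positions are not all in \<open>D\<close>. So merging keeps the composition alive.\<close>
    have "\<xi>1 c = 0" if c: "length c = i" "0 \<notin> set c" "sum_list c = m" "alive N D c" for c
    proof -
      from c 3 obtain a b r where abr: "c = a # b # r"
        by (cases c; cases "tl c") auto
      show ?thesis
      proof (cases "a = 1")
        case True
        have "alive N D ((1 + b) # r)"
        proof (rule alive_merge[OF N1])
          show "alive N D (1 # b # r)" using c abr True by simp
        qed (use 3 in auto)
        with c abr True show ?thesis unfolding abr True by (intro \<xi>1_merge) auto
      next
        case False
        with c abr have "a \<ge> 2" by (cases a) auto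
        with abr \<xi>1_ge2 show ?thesis by simp
      qed
    qed
    then show ?thesis by (intro exI[of _ \<eta>1]) (auto simp: \<xi>1_def)
  next
    case 4
    \<comment> \<open>The same idea one block later: N - 1 is split off the second block. The sign
      is now plus, as splittings of the second block enter \<open>bd\<close> with the opposite
      sign.\<close>
    define \<eta>2 :: "nat list \<Rightarrow> 'a" where
      "\<eta>2 c = (case c of a # x # b # r \<Rightarrow> if a = 1 \<and> x = N - 1 then \<xi>1 (1 # (N - 1 + b) # r) else 0 | _ \<Rightarrow> 0)" for c
    have \<eta>2_Cons: "\<eta>2 (a # x # b # r) = (if a = 1 \<and> x = N - 1 then \<xi>1 (1 # (N - 1 + b) # r) else 0)" for a x b r
      by (simp add: \<eta>2_def)
    have \<eta>2_ne: "\<eta>2 (a # c) = 0" if "a \<noteq> 1" for a c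
      using that by (auto simp: \<eta>2_def split: list.splits)
    have \<eta>2_ne': "\<eta>2 (a # x # c) = 0" if "x \<noteq> N - 1" for a x c
      using that by (auto simp: \<eta>2_def split: list.splits)
    define \<xi>2 where "\<xi>2 c = \<xi>1 c - bd \<eta>2 c" for c
    have cyc2: "bd \<xi>2 c = 0" if "Suc (length c) = i" "0 \<notin> set c" "sum_list c = m" "alive N D c" for c
      unfolding \<xi>2_def bd_diff using cyc1[OF that] by simp
    have dead: "\<not> alive N D (a # r)" if "a \<ge> N" for a r
      using 4 that N1 by (auto simp: alive_Cons intro!: exI[of _ 0])
    have \<xi>2_big: "\<xi>2 (a # r) = 0" if "a \<ge> 2" "a \<noteq> N" for a r
    proof -
      have "(\<Sum>x=1..<a. \<eta>2 (x # (a - x) # r)) = 0"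
      proof (rule sum.neutral, safe)
        fix x assume "x \<in> {1..<a}"
        then show "\<eta>2 (x # (a - x) # r) = 0"
          using that \<eta>2_ne[of x] \<eta>2_ne'[of "a - x"] by (cases "x = 1") auto
      qed
      then show ?thesis using that by (simp add: \<xi>2_def \<xi>1_ge2 \<eta>2_ne)
    qed
    have sum\<eta>2: "(\<Sum>x=1..<b. \<eta>2 (1 # x # (b - x) # r)) = (if N \<le> b then \<xi>1 (1 # b # r) else 0)" for b r
    proof -
      have "(\<Sum>x=1..<b. \<eta>2 (1 # x # (b - x) # r)) = (\<Sum>x=1..<b. if x = N - 1 then \<xi>1 (1 # b # r) else 0)"
        by (intro sum.cong) (auto simp: \<eta>2_Cons)
      also have "\<dots> = (if N \<le> b then \<xi>1 (1 # b # r) else 0)"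
        using N by (auto simp: sum.delta)
      finally show ?thesis .
    qed
    have \<xi>2_1: "\<xi>2 (1 # b # r) = (if N \<le> b then 0 else \<xi>1 (1 # b # r))" if "b \<noteq> N - 1" for b r
      using that sum\<eta>2[of b r] by (auto simp: \<xi>2_def \<eta>2_ne')
    \<comment> \<open>For N \<le> b this is the effect of \<open>\<eta>2\<close>. Otherwise 1 + b <
      N, the merged block is too short for a window, and the cycle condition applies.\<close>
    have \<xi>2_short: "\<xi>2 (1 # b # r) = 0"
      if c: "length r + 2 = i" "0 \<notin> set r" "b \<noteq> 0" "sum_list r + Suc b = m" "alive N D (1 # b # r)" "b \<noteq> N - 1" for b r
    proof (cases "N \<le> b")
      case False
      have "alive N D ((1 + b) # r)"
        by (rule alive_merge[OF N1 c(5)]) (use c False in auto)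
      with c False show ?thesis using \<xi>2_1[of b r] \<xi>1_merge[of r b] by simp
    qed (use that \<xi>2_1[of b r] in simp)
    have supp: "\<exists>r. c = 1 # (N - 1) # r"
      if c: "length c = i" "0 \<notin> set c" "sum_list c = m" "alive N D c" "\<xi>2 c \<noteq> 0" for c
    proof -
      from c 4 obtain a b r where abr: "c = a # b # r"
        by (cases c; cases "tl c") auto
      have "a = 1"
      proof (rule ccontr)
        assume "a \<noteq> 1"
        with c abr have "a \<ge> 2" by (cases a) auto
        moreover have "a \<noteq> N" using dead[of a "b # r"] c abr by auto
        ultimately show False using \<xi>2_big c abr by auto
      qed
      moreover have "b = N - 1"
        using \<xi>2_short[of r b] c \<open>a = 1\<close> unfolding abr by auto
      ultimately show ?thesis using abr by blast
    qed
    have fin12: "\<exists>\<eta>. \<forall>c. length c = i \<longrightarrow> 0 \<notin> set c \<longrightarrow> sum_list c = m \<longrightarrow> alive N D c \<longrightarrow> bd \<eta> c = \<xi> c"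
      if "\<And>c. length c = i \<Longrightarrow> 0 \<notin> set c \<Longrightarrow> sum_list c = m \<Longrightarrow> alive N D c \<Longrightarrow> \<xi>2 c = bd \<eta>3 c" for \<eta>3
    proof (intro exI[of _ "\<lambda>c. \<eta>1 c + (\<eta>2 c + \<eta>3 c)"] allI impI)
      fix c assume "length c = i" "0 \<notin> set c" "sum_list c = m" "alive N D c"
      from that[OF this] show "bd (\<lambda>c. \<eta>1 c + (\<eta>2 c + \<eta>3 c)) c = \<xi> c"
        by (simp add: bd_add \<xi>2_def \<xi>1_def algebra_simps)
    qed
    have alive_shift: "alive N D (1 # (N - 1) # r) \<longleftrightarrow> alive N {i. i + N \<in> D} r" for r
    proof -
      have "{i. i + (N - 1) \<in> {i. i + 1 \<in> D}} = {i. i + N \<in> D}" using N by (auto simp: algebra_simps)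
      then show ?thesis using N alive_small[of N 1 D] alive_small[of N "N - 1" "{i. i + 1 \<in> D}"] by simp
    qed
    \<comment> \<open>Position N - 1 is the cut after the blocks 1, N - 1. If it lies outside
      \<open>D\<close>, merging the second and third block keeps the composition alive and the cycle
      condition kills the chain. If it lies in \<open>D\<close>, second blocks of \<open>N\<close>
      or more letters are dead, and the pair of blocks splits off as a factor.\<close>
    consider "m < N" | "m > N" "N - 1 \<notin> D" | "m \<ge> N" "m > N \<Longrightarrow> N - 1 \<in> D" by linarith
    then show ?thesis
    proof cases
      case 1
      have "\<xi>2 c = bd (\<lambda>_. 0) c" if c: "length c = i" "0 \<notin> set c" "sum_list c = m" "alive N D c" for c
      proof (rule ccontr)
        assume "\<xi>2 c \<noteq> bd (\<lambda>_. 0) c"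
        then obtain r where "c = 1 # (N - 1) # r" using supp c by auto
        with c 1 show False by auto
      qed
      then show ?thesis by (rule fin12)
    next
      case 2
      have "\<xi>2 c = bd (\<lambda>_. 0) c" if c: "length c = i" "0 \<notin> set c" "sum_list c = m" "alive N D c" for c
      proof (rule ccontr)
        assume ne: "\<xi>2 c \<noteq> bd (\<lambda>_. 0) c"
        then obtain r' where r': "c = 1 # (N - 1) # r'" using supp c by auto
        then obtain b r where r: "r' = b # r" using c 2 N by (cases r') auto
        define b' where "b' = N - 1 + b"
        have al: "alive N {i. i + 1 \<in> D} (b' # r)" unfolding b'_def
        proof (rule alive_merge[OF N1])
          show "alive N {i. i + 1 \<in> D} ((N - 1) # b # r)"
            using c r r' N alive_small[of N 1 D] by simp
        next
          fix a assume "a < N - 1" "N - 1 < a + N"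
          \<comment> \<open>N - 2 is the position N - 1 of the whole, renumbered after removal of
            the first letter.\<close>
          then have "N - 2 \<in> {a..<a + N - 1}" by auto
          moreover have "N - 2 \<notin> {i. i + 1 \<in> D}" using 2 N by (auto simp: numeral_2_eq_2 Suc_diff_Suc)
          ultimately show "\<not> {a..<a + N - 1} \<subseteq> {i. i + 1 \<in> D}" by blast
        qed
        then have al': "alive N D (1 # b' # r)" using N alive_small[of N 1 D] by simp
        have b: "b > 0" "b' \<ge> N" "0 \<notin> set r" using c r r' N by (auto simp: b'_def)
        have len: "length r + 3 = i" "sum_list r + Suc b' = m" using c r r' by (auto simp: b'_def)
        have "bd \<xi>2 (1 # b' # r) = 0" using al' b len N by (intro cyc2) auto
        moreover have "\<xi>2 (1 # b' # c) = 0" for c using b N by (subst \<xi>2_1) auto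
        moreover have "\<xi>2 (1 # x # (b' - x) # r) = 0" if x: "x \<in> {1..<b'}" "x \<noteq> N - 1" for x
        proof (rule \<xi>2_short)
          have "alive N {i. i + 1 \<in> D} (x # (b' - x) # r)"
            by (rule alive_split[OF N1]) (use al x in simp)
          then show "alive N D (1 # x # (b' - x) # r)" using N alive_small[of N 1 D] by simp
        qed (use x b len in auto)
        then have "(\<Sum>x=1..<b'. \<xi>2 (1 # x # (b' - x) # r)) = (\<Sum>x\<in>{N - 1}. \<xi>2 (1 # x # (b' - x) # r))"
          using b N by (intro sum.mono_neutral_right) auto
        ultimately have "\<xi>2 (1 # (N - 1) # b # r) = 0" by (simp add: b'_def)
        with ne r r' show False by simp
      qed
      then show ?thesis by (rule fin12)
    next
      case 3
      have i: "i - 2 < i" "Suc (Suc (i - 2)) = i" using 4 by auto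
      have "m - N \<noteq> nuN N (i - 2)" using less.prems(1) nuN_add_2[of N "i - 2"] i 3 by auto
      moreover have "bd (\<lambda>r. \<xi>2 (1 # (N - 1) # r)) r = 0"
        if r: "Suc (length r) = i - 2" "0 \<notin> set r" "sum_list r = m - N" "alive N {i. i + N \<in> D} r" for r
      proof -
        have "bd \<xi>2 (1 # (N - 1) # r) = 0"
          using r N 3 alive_shift[of r] by (intro cyc2) auto
        moreover have "\<xi>2 (1 # x # (N - 1 - x) # r) = 0" if x: "x \<in> {1..<N - 1}" for x
        proof (rule \<xi>2_short)
          have "alive N {i. i + 1 \<in> D} (x # (N - 1 - x) # r)"
          proof (rule alive_split[OF N1])
            have "alive N D (1 # (N - 1) # r)" using r(4) alive_shift[of r] by blast
            then have "alive N {i. i + 1 \<in> D} ((N - 1) # r)" using alive_small[OF N1, of 1 D] N by simp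
            moreover have "x + (N - 1 - x) = N - 1" using x by auto
            ultimately show "alive N {i. i + 1 \<in> D} ((x + (N - 1 - x)) # r)" by (simp only:)
          qed
          then show "alive N D (1 # x # (N - 1 - x) # r)" using N alive_small[of N 1 D] by simp
        qed (use x r 3 N in auto)
        ultimately show ?thesis by simp
      qed
      ultimately obtain \<eta> where \<eta>: "\<And>c. length c = i - 2 \<Longrightarrow> 0 \<notin> set c \<Longrightarrow> sum_list c = m - N \<Longrightarrow>
          alive N {i. i + N \<in> D} c \<Longrightarrow> bd \<eta> c = \<xi>2 (1 # (N - 1) # c)"
        using less.IH[OF i(1), of "m - N" "{i. i + N \<in> D}" "\<lambda>r. \<xi>2 (1 # (N - 1) # r)"] by metis
      \<comment> \<open>The solution for the tail, extended by 0. Passing two leading blocks changes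
        the sign twice, so \<open>bd\<close> acts on the tail without a sign.\<close>
      define \<eta>3 where "\<eta>3 c = (case c of a # x # r \<Rightarrow> if a = 1 \<and> x = N - 1 then \<eta> r else 0 | _ \<Rightarrow> 0)" for c
      have \<eta>3_Cons: "\<eta>3 (a # x # r) = (if a = 1 \<and> x = N - 1 then \<eta> r else 0)" for a x r
        by (simp add: \<eta>3_def)
      have \<eta>3_ne: "\<eta>3 (a # r) = 0" if "a \<noteq> 1" for a r
        using that by (auto simp: \<eta>3_def split: list.splits)
      have "\<xi>2 c = bd \<eta>3 c" if c: "length c = i" "0 \<notin> set c" "sum_list c = m" "alive N D c" for c
      proof -
        from c 4 obtain a b r where abr: "c = a # b # r"
          by (cases c; cases "tl c") auto
        show ?thesis
        proof (cases "a = 1")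
          case False
          then have "\<xi>2 c = 0" using supp[OF c] abr False by auto
          moreover have "a \<noteq> N" using dead[of a "b # r"] c abr by auto
          then have "(\<Sum>x=1..<a. \<eta>3 (x # (a - x) # b # r)) = 0"
            using N by (intro sum.neutral ballI) (auto simp: \<eta>3_Cons)
          ultimately show ?thesis using False by (simp add: abr \<eta>3_ne)
        next
          case True
          have "(\<Sum>x=1..<b. \<eta>3 (1 # x # (b - x) # r)) = 0"
          proof (rule sum.neutral, rule ballI, rule ccontr)
            fix x assume x: "x \<in> {1..<b}" "\<eta>3 (1 # x # (b - x) # r) \<noteq> 0"
            then have b: "N \<le> b" by (auto simp: \<eta>3_Cons split: if_splits)
            then have "m > N" using c abr True by auto
            then have "N - 1 \<in> D" using 3 by blast
            have "{0..<0 + N - 1} \<subseteq> {i. i + 1 \<in> D}"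
            proof
              fix j assume "j \<in> {0..<0 + N - 1}"
              then have "j + 1 \<in> {0..<N - 1} \<or> j + 1 = N - 1" by auto
              then show "j \<in> {i. i + 1 \<in> D}" using 4 \<open>N - 1 \<in> D\<close> by auto
            qed
            moreover have "alive N {i. i + 1 \<in> D} (b # r)"
              using c(4) abr True alive_small[of N 1 D] N by simp
            then have "\<not> {0..<0 + N - 1} \<subseteq> {i. i + 1 \<in> D}"
              using b N1 unfolding alive_Cons[OF N1] by (metis add_0)
            ultimately show False by blast
          qed
          then have bd: "bd \<eta>3 c = bd (\<lambda>r. \<eta>3 (1 # b # r)) r" by (simp add: abr True)
          show ?thesis
          proof (cases "b = N - 1")
            case b: True
            have "bd \<eta> r = \<xi>2 (1 # (N - 1) # r)"
              using c abr True b N alive_shift[of r] by (intro \<eta>) auto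
            then show ?thesis using bd abr True b by (simp add: \<eta>3_Cons)
          next
            case False
            then have "\<xi>2 c = 0" using supp[OF c] abr False by auto
            then show ?thesis using bd False by (simp add: \<eta>3_Cons)
          qed
        qed
      qed
      then show ?thesis by (rule fin12)
    qed
  qed
qed

section \<open>Reduced words and the q-symmetrizer\<close>

text \<open>One word for each permutation of 1, ..., g + 1. In the step \<open>v\<close> belongs to
  the subgroup fixing g + 2, and the descending chain from g + 1 to k represents the coset; it is
  empty for k = g + 2.\<close>

fun normal_words :: "nat \<Rightarrow> nat list set" where
  "normal_words 0 = {[]}"
| "normal_words (Suc g) = (\<lambda>(v, k). v @ rev [k..<g + 2]) ` (normal_words g \<times> {1..g + 2})"

lemma perm_of_word_Nil [simp]: "perm_of_word [] = id"
  and perm_of_word_Cons [simp]: "perm_of_word (i # w) = transpose i (Suc i) \<circ> perm_of_word w"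
  by (simp_all add: perm_of_word_def)

lemma perm_of_word_append [simp]: "perm_of_word (u @ w) = perm_of_word u \<circ> perm_of_word w"
  by (induction u) (auto simp: fun_eq_iff)

lemma perm_of_word_rev: "perm_of_word w \<circ> perm_of_word (rev w) = id"
proof (induction w)
  case (Cons i w)
  then have "perm_of_word w (perm_of_word (rev w) x) = x" for x by (metis comp_apply id_apply)
  then show ?case by (simp add: fun_eq_iff)
qed simp

lemma perm_of_word_permutes: "set w \<subseteq> {1..g} \<Longrightarrow> perm_of_word w permutes {1..Suc g}"
proof (induction w)
  case (Cons i w)
  then have "perm_of_word w permutes {1..Suc g}" "transpose i (Suc i) permutes {1..Suc g}"
    by (auto intro: permutes_swap_id)
  then show ?case unfolding perm_of_word_Cons by (rule permutes_compose)
qed (simp add: permutes_id)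

lemma perm_of_word_fixes: "set w \<subseteq> {1..g} \<Longrightarrow> perm_of_word w (g + 2) = g + 2"
  using perm_of_word_permutes[of w g] by (intro permutes_not_in) auto

lemma perm_of_chain: "k \<le> n \<Longrightarrow> perm_of_word (rev [k..<n]) k = n"
  by (induction n) (auto simp: le_Suc_eq)

lemma normal_words_set: "w \<in> normal_words g \<Longrightarrow> set w \<subseteq> {1..g}"
  by (induction g arbitrary: w) fastforce+

text \<open>\<open>k\<close> is the preimage of g + 2 under the permutation; once it is known, the
  chain cancels on the right.\<close>

lemma normal_words_split:
  assumes "v \<in> normal_words g" "v' \<in> normal_words g" "k \<in> {1..g + 2}" "k' \<in> {1..g + 2}"
    and eq: "perm_of_word (v @ rev [k..<g + 2]) = perm_of_word (v' @ rev [k'..<g + 2])"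
  shows "k = k' \<and> perm_of_word v = perm_of_word v'"
proof -
  have *: "perm_of_word (v @ rev [k..<g + 2]) k = g + 2" if "v \<in> normal_words g" "k \<in> {1..g + 2}" for v k
    using that perm_of_chain[of k "g + 2"] perm_of_word_fixes[OF normal_words_set] by simp
  have "perm_of_word (v @ rev [k..<g + 2]) permutes {1..Suc (Suc g)}"
    by (rule perm_of_word_permutes) (use assms normal_words_set in fastforce)
  then have "inj (perm_of_word (v @ rev [k..<g + 2]))" by (rule permutes_inj)
  then have "k = k'" using *[OF assms(1,3)] *[OF assms(2,4)] eq by (metis injD)
  have "perm_of_word v = perm_of_word v \<circ> (perm_of_word (rev [k..<g + 2]) \<circ> perm_of_word (rev (rev [k..<g + 2])))"
    by (simp only: perm_of_word_rev) simp
  also have "\<dots> = perm_of_word (v' @ rev [k..<g + 2]) \<circ> perm_of_word (rev (rev [k..<g + 2]))"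
    using eq \<open>k = k'\<close> by (simp only: o_assoc perm_of_word_append)
  also have "\<dots> = perm_of_word v'"
    by (simp only: perm_of_word_append o_assoc[symmetric] perm_of_word_rev) simp
  finally show ?thesis using \<open>k = k'\<close> by simp
qed

lemma finite_normal_words [simp]: "finite (normal_words g)"
  by (induction g) auto

lemma inj_perm_normal: "inj_on perm_of_word (normal_words g)"
proof (induction g)
  case (Suc g)
  show ?case
  proof (rule inj_onI)
    fix x y assume "x \<in> normal_words (Suc g)" "y \<in> normal_words (Suc g)" "perm_of_word x = perm_of_word y"
    moreover from this obtain v k v' k' where *: "x = v @ rev [k..<g + 2]" "y = v' @ rev [k'..<g + 2]"
      "v \<in> normal_words g" "v' \<in> normal_words g" "k \<in> {1..g + 2}" "k' \<in> {1..g + 2}" by auto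
    ultimately have "k = k' \<and> perm_of_word v = perm_of_word v'" using normal_words_split by blast
    with * Suc show "x = y" by (auto dest: inj_onD)
  qed
qed simp

lemma inj_normal_parts: "inj_on (\<lambda>(v, k). v @ rev [k..<g + 2]) (normal_words g \<times> {1..g + 2})"
proof (rule inj_onI, clarify)
  fix v k v' k' assume *: "v \<in> normal_words g" "v' \<in> normal_words g" "k \<in> {1..g + 2}" "k' \<in> {1..g + 2}"
    "v @ rev [k..<g + 2] = v' @ rev [k'..<g + 2]"
  then have "k = k'" using normal_words_split[OF *(1-4)] by simp
  with * show "v = v' \<and> k = k'" by simp
qed

lemma bij_perm_normal: "bij_betw perm_of_word (normal_words g) {\<sigma>. \<sigma> permutes {1..Suc g}}"
proof -
  have "card (normal_words g) = fact (Suc g)"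
  proof (induction g)
    case (Suc g)
    have "card (normal_words (Suc g)) = card (normal_words g \<times> {1..g + 2})"
      unfolding normal_words.simps by (rule card_image[OF inj_normal_parts])
    with Suc show ?case by simp
  qed simp
  then have "card (perm_of_word ` normal_words g) = card {\<sigma>. \<sigma> permutes {1..Suc g}}"
    by (simp add: card_image[OF inj_perm_normal] card_permutations)
  moreover have "perm_of_word ` normal_words g \<subseteq> {\<sigma>. \<sigma> permutes {1..Suc g}}"
    using perm_of_word_permutes normal_words_set by blast
  ultimately have "perm_of_word ` normal_words g = {\<sigma>. \<sigma> permutes {1..Suc g}}"
    by (intro card_subset_eq) (auto simp: finite_permutations)
  with inj_perm_normal show ?thesis by (simp add: bij_betw_def)
qed

lemma reduced_expr_some:
  assumes "\<sigma> permutes {1..Suc g}"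
  shows "reduced_expr (Suc g) (SOME ws. reduced_expr (Suc g) ws \<sigma>) \<sigma>"
proof -
  let ?P = "\<lambda>ws. set ws \<subseteq> {1..g} \<and> perm_of_word ws = \<sigma>"
  have g: "{1..<Suc g} = {1..g}" by auto
  have "\<sigma> \<in> perm_of_word ` normal_words g"
    using bij_perm_normal[of g] assms by (simp add: bij_betw_def)
  then obtain w where "?P w" using normal_words_set by blast
  from ex_has_least_nat[of ?P, OF this, of length]
  obtain ws where "?P ws" "\<forall>ws'. ?P ws' \<longrightarrow> length ws \<le> length ws'" by blast
  then have "\<exists>ws. reduced_expr (Suc g) ws \<sigma>" unfolding reduced_expr_def g by blast
  then show ?thesis by (rule someI_ex)
qed

section \<open>Independence of the choice of reduced expressions\<close>

locale braid_action =
  fixes t :: "nat \<Rightarrow> 'b \<Rightarrow> 'b" and g :: nat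
  assumes braid: "1 \<le> i \<Longrightarrow> i < g \<Longrightarrow> t i (t (Suc i) (t i v)) = t (Suc i) (t i (t (Suc i) v))"
    and comm: "1 \<le> i \<Longrightarrow> j \<le> g \<Longrightarrow> Suc i < j \<Longrightarrow> t i (t j v) = t j (t i v)"
begin

text \<open>Replaces equivalence under braid moves. Instead of generating a rewriting relation it
  records the three invariants of such moves that matter here.\<close>

definition eqv :: "nat list \<Rightarrow> nat list \<Rightarrow> bool" (infix \<open>\<approx>\<close> 50) where
  "u \<approx> w \<longleftrightarrow> perm_of_word u = perm_of_word w \<and> length u = length w \<and> foldr t u = foldr t w"

lemma eqv_refl [simp]: "u \<approx> u" by (simp add: eqv_def)
lemma eqv_sym: "u \<approx> w \<Longrightarrow> w \<approx> u" by (simp add: eqv_def)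
lemma eqv_trans [trans]: "u \<approx> v \<Longrightarrow> v \<approx> w \<Longrightarrow> u \<approx> w" by (simp add: eqv_def)
lemma eqv_append: "u \<approx> u' \<Longrightarrow> w \<approx> w' \<Longrightarrow> u @ w \<approx> u' @ w'"
  by (simp add: eqv_def fun_eq_iff)

lemma eqv_comm: "1 \<le> i \<Longrightarrow> j \<le> g \<Longrightarrow> Suc i < j \<Longrightarrow> [i, j] \<approx> [j, i]"
  using comm[of i j] by (auto simp: eqv_def fun_eq_iff transpose_def)

lemma eqv_braid: "1 \<le> i \<Longrightarrow> i < g \<Longrightarrow> [i, Suc i, i] \<approx> [Suc i, i, Suc i]"
  by (auto simp: eqv_def braid fun_eq_iff transpose_def)

lemma eqv_comm_list:
  assumes "1 \<le> i" "i \<le> g" "\<And>j. j \<in> set w \<Longrightarrow> 1 \<le> j \<and> j \<le> g \<and> (Suc i < j \<or> Suc j < i)"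
  shows "w @ [i] \<approx> i # w"
  using assms(3)
proof (induction w)
  case (Cons j w)
  have "w @ [i] \<approx> i # w" by (rule Cons.IH) (rule Cons.prems, simp)
  from eqv_append[OF eqv_refl this, of "[j]"] have "[j] @ w @ [i] \<approx> [j] @ [i] @ w" by simp
  also have "[j, i] \<approx> [i, j]" using Cons.prems[of j] assms(1,2) eqv_comm eqv_sym by auto
  then have "[j, i] @ w \<approx> [i, j] @ w" by (rule eqv_append) simp
  then have "[j] @ [i] @ w \<approx> i # j # w" by simp
  finally show ?case by simp
qed simp

text \<open>The letter i commutes leftwards until it meets i, i - 1; the braid relation turns i, i -
  1, i into i - 1, i, i - 1, and the first i - 1 commutes to the front.\<close>

lemma chain_shift:
  assumes "1 \<le> k" "k < i" "i < n" "n \<le> Suc g"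
  shows "rev [k..<n] @ [i] \<approx> (i - 1) # rev [k..<n]"
proof -
  obtain i' where i': "i = Suc i'" using assms by (cases i) auto
  then have i1: "i - 1 = i'" by simp
  let ?hi = "rev [Suc i..<n]" and ?lo = "rev [k..<i']"
  have eq: "rev [k..<n] = ?hi @ [i, i'] @ ?lo"
  proof -
    have "[k..<n] = [k..<i'] @ [i'..<n]"
      using assms i' upt_add_eq_append[of k i' "n - i'"] by simp
    also have "[i'..<n] = i' # i # [Suc i..<n]" using assms i' by (simp add: upt_rec)
    finally show ?thesis by simp
  qed
  have "?lo @ [i] \<approx> i # ?lo" by (rule eqv_comm_list) (use assms i' in auto)
  then have "(?hi @ [i, i']) @ ?lo @ [i] \<approx> (?hi @ [i, i']) @ i # ?lo" by (rule eqv_append[OF eqv_refl])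
  also have "[i, i', i] \<approx> [i', i, i']" unfolding i' by (rule eqv_sym, rule eqv_braid) (use assms i' in auto)
  then have "(?hi @ [i, i', i]) @ ?lo \<approx> (?hi @ [i', i, i']) @ ?lo" by (intro eqv_append eqv_refl)
  then have "(?hi @ [i, i']) @ i # ?lo \<approx> (?hi @ [i']) @ [i, i'] @ ?lo" by simp
  also have "?hi @ [i'] \<approx> i' # ?hi" by (rule eqv_comm_list) (use assms i' in auto)
  then have "(?hi @ [i']) @ [i, i'] @ ?lo \<approx> (i' # ?hi) @ [i, i'] @ ?lo" by (rule eqv_append) simp
  finally show ?thesis by (simp only: eq append_assoc append_Cons append_Nil i1)
qed

text \<open>The second alternative says that i is a right descent of \<open>w\<close>. Against the
  chain ending in k: below k - 1 the letter commutes through, k - 1 prolongs the chain, k is its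
  last letter (the descent), and a larger letter passes through lowered by 1. After passing,
  induction applies to \<open>v\<close>.\<close>

lemma normal_words_step:
  assumes "h \<le> g" "w \<in> normal_words h" "1 \<le> i" "i \<le> h"
  shows "(\<exists>w'\<in>normal_words h. w @ [i] \<approx> w') \<or> (\<exists>u. set u \<subseteq> {1..h} \<and> w \<approx> u @ [i])"
  using assms
proof (induction h arbitrary: w i)
  case (Suc h)
  obtain v k where w: "w = v @ rev [k..<h + 2]" "v \<in> normal_words h" "1 \<le> k" "k \<le> h + 2"
    using Suc.prems by auto
  have set_C: "set (rev [k..<h + 2]) \<subseteq> {1..Suc h}" using w by auto
  have set_v: "set v \<subseteq> {1..Suc h}" using normal_words_set[OF w(2)] by auto
  let ?C = "rev [k..<h + 2]"
  have via: ?case if i': "1 \<le> i'" "i' \<le> h" and C: "?C @ [i] \<approx> i' # ?C" for i'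
  proof -
    have wi: "w @ [i] \<approx> (v @ [i']) @ ?C"
      using eqv_append[OF eqv_refl C, of v] by (simp add: w)
    from Suc.IH[OF _ w(2) i'] Suc.prems consider
        v' where "v' \<in> normal_words h" "v @ [i'] \<approx> v'" | u where "set u \<subseteq> {1..h}" "v \<approx> u @ [i']"
      by auto
    then show ?thesis
    proof cases
      case 1
      have "w @ [i] \<approx> v' @ ?C" by (rule eqv_trans[OF wi eqv_append[OF 1(2) eqv_refl]])
      moreover have "v' @ ?C \<in> normal_words (Suc h)" using 1 w by (auto intro!: rev_image_eqI[of "(v', k)"])
      ultimately show ?thesis by blast
    next
      case 2
      have "w \<approx> (u @ [i']) @ ?C" unfolding w(1) by (rule eqv_append[OF 2(2) eqv_refl])
      also have "(u @ [i']) @ ?C \<approx> (u @ ?C) @ [i]"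
        using eqv_append[OF eqv_refl eqv_sym[OF C], of u] by simp
      finally have "w \<approx> (u @ ?C) @ [i]" .
      moreover have "set (u @ ?C) \<subseteq> {1..Suc h}" using 2 set_C by auto
      ultimately show ?thesis by blast
    qed
  qed
  consider "i < k - 1" | "i = k - 1" | "i = k" | "k < i" by linarith
  then show ?case
  proof cases
    case 1
    have "?C @ [i] \<approx> i # ?C" by (rule eqv_comm_list) (use 1 Suc.prems in auto)
    with 1 Suc.prems w show ?thesis by (intro via[of i]) auto
  next
    case 2
    then have "k = Suc i" using Suc.prems by auto
    have "w @ [i] = v @ rev [i..<h + 2]"
      using w(1) Suc.prems(4) by (simp add: \<open>k = Suc i\<close> upt_conv_Cons del: upt_Suc)
    also have "\<dots> \<in> normal_words (Suc h)"
      unfolding normal_words.simps using w(2) Suc.prems(3,4)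
      by (intro rev_image_eqI[of "(v, i)"]) auto
    finally show ?thesis using eqv_refl by blast
  next
    case 3
    have weq: "w = (v @ rev [Suc i..<h + 2]) @ [i]"
      using w 3 Suc.prems by (simp add: upt_conv_Cons del: upt_Suc)
    have "w \<approx> (v @ rev [Suc i..<h + 2]) @ [i]" by (subst weq) (rule eqv_refl)
    moreover have "set (v @ rev [Suc i..<h + 2]) \<subseteq> {1..Suc h}" using set_v by auto
    ultimately show ?thesis by blast
  next
    case 4
    have "?C @ [i] \<approx> (i - 1) # ?C" by (rule chain_shift) (use 4 Suc.prems w in auto)
    with 4 Suc.prems w show ?thesis by (intro via[of "i - 1"]) auto
  qed
qed simp

text \<open>The prefix is equivalent to a normal word by induction; if the last letter were a
  descent of it, a shorter word would give the same permutation.\<close>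

lemma reduced_eqv_normal:
  "set ws \<subseteq> {1..g} \<Longrightarrow>
    (\<And>ws'. set ws' \<subseteq> {1..g} \<Longrightarrow> perm_of_word ws' = perm_of_word ws \<Longrightarrow> length ws \<le> length ws') \<Longrightarrow>
    \<exists>w\<in>normal_words g. ws \<approx> w"
proof (induction ws rule: rev_induct)
  case Nil
  have "[] \<in> normal_words h" for h
  proof (induction h)
    case (Suc h)
    then have "([], h + 2) \<in> normal_words h \<times> {1..h + 2}" by simp
    then show ?case unfolding normal_words.simps by (rule rev_image_eqI) simp
  qed simp
  then show ?case by (intro bexI[of _ "[]"]) auto
next
  case (snoc i ws)
  have "length ws \<le> length ws'" if "set ws' \<subseteq> {1..g}" "perm_of_word ws' = perm_of_word ws" for ws'
    using snoc.prems(2)[of "ws' @ [i]"] that snoc.prems(1) by simp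
  then obtain w where w: "w \<in> normal_words g" "ws \<approx> w" using snoc by auto
  have "\<not> (w \<approx> u @ [i])" if u: "set u \<subseteq> {1..g}" for u
  proof
    assume "w \<approx> u @ [i]"
    with w have wu: "ws \<approx> u @ [i]" by (blast intro: eqv_trans)
    have "transpose i (Suc i) \<circ> transpose i (Suc i) = id" by simp
    then have "perm_of_word (ws @ [i]) = perm_of_word u"
      using wu by (simp add: eqv_def o_assoc[symmetric])
    then have "length (ws @ [i]) \<le> length u" using snoc.prems(2)[OF u] by simp
    with wu show False by (simp add: eqv_def)
  qed
  then obtain w' where "w' \<in> normal_words g" "w @ [i] \<approx> w'"
    using normal_words_step[OF le_refl w(1), of i] snoc.prems(1) by auto
  with w(2) show ?case by (meson eqv_append eqv_refl eqv_trans)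
qed

lemma foldr_reduced:
  assumes "w \<in> normal_words g"
  shows "foldr t (SOME ws. reduced_expr (Suc g) ws (perm_of_word w)) = foldr t w"
proof -
  have g: "{1..<Suc g} = {1..g}" by auto
  define ws where "ws = (SOME ws. reduced_expr (Suc g) ws (perm_of_word w))"
  have "perm_of_word w permutes {1..Suc g}"
    using perm_of_word_permutes normal_words_set[OF assms] by blast
  from reduced_expr_some[OF this, folded ws_def]
  have ws: "set ws \<subseteq> {1..g}" "perm_of_word ws = perm_of_word w"
      "\<And>ws'. set ws' \<subseteq> {1..g} \<Longrightarrow> perm_of_word ws' = perm_of_word ws \<Longrightarrow> length ws \<le> length ws'"
    unfolding reduced_expr_def g by auto
  from reduced_eqv_normal[OF ws(1,3)] obtain w' where w': "w' \<in> normal_words g" "ws \<approx> w'" by blast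
  then have "perm_of_word w' = perm_of_word w" using ws(2) by (simp add: eqv_def)
  with w' assms inj_perm_normal have "w' = w" by (auto dest: inj_onD)
  with w' show ?thesis by (simp add: eqv_def ws_def)
qed

lemma sum_reduced:
  fixes f :: "('b \<Rightarrow> 'b) \<Rightarrow> 'c::comm_monoid_add"
  shows "(\<Sum>\<sigma>\<in>{\<sigma>. \<sigma> permutes {1..Suc g}}. f (foldr t (SOME ws. reduced_expr (Suc g) ws \<sigma>)))
    = (\<Sum>w\<in>normal_words g. f (foldr t w))"
  unfolding sum.reindex_bij_betw[OF bij_perm_normal, symmetric]
  by (rule sum.cong) (simp_all add: foldr_reduced)

end

section \<open>The sum of all \<open>T_\<sigma>\<close> and its absorption property\<close>

context hecke_action begin

text \<open>1 + t (k - 1) + t (k - 1) t (k - 2) + ..., the sum over the k + 1 coset chains. The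
  product of these factors in \<open>perm_sum\<close> is the sum over normal words
  (\<open>perm_sum_normal\<close>).\<close>

primrec chain_sum :: "nat \<Rightarrow> 'b \<Rightarrow> 'b" where
  "chain_sum 0 v = v"
| "chain_sum (Suc k) v = v + t k (chain_sum k v)"

primrec perm_sum :: "nat \<Rightarrow> 'b \<Rightarrow> 'b" where
  "perm_sum 0 v = v"
| "perm_sum (Suc k) v = perm_sum k (chain_sum (Suc k) v)"

lemma chain_sum_add: "k \<le> n \<Longrightarrow> chain_sum k (u + v) = chain_sum k u + chain_sum k v"
  by (induction k) (auto simp: t_add)

lemma chain_sum_commutes:
  "k \<le> n \<Longrightarrow> j < n \<Longrightarrow> k < j \<Longrightarrow> t j (chain_sum k v) = chain_sum k (t j v)"
proof (induction k)
  case (Suc k)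
  then show ?case using comm[of j k "chain_sum k v"] by (simp add: t_add)
qed simp

lemma perm_sum_commutes:
  "k \<le> n \<Longrightarrow> j < n \<Longrightarrow> k < j \<Longrightarrow> t j (perm_sum k v) = perm_sum k (t j v)"
  by (induction k arbitrary: v) (auto simp: chain_sum_commutes simp del: chain_sum.simps)

text \<open>Two consecutive factors give (1 + t k) applied to a vector, plus a term
  \<open>H\<close>. The quadratic relation makes the first a q-eigenvector of t k; the braid
  relation and the induction hypothesis do so for \<open>H\<close>.\<close>

lemma chain_sum_absorb:
  "k < n \<Longrightarrow> t k (chain_sum k (chain_sum (Suc k) v)) = q *s chain_sum k (chain_sum (Suc k) v)"
proof (induction k arbitrary: v)
  case 0
  then show ?case by (simp add: t_add quad scale_left_diff_distrib scale_right_distrib)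
next
  case (Suc j)
  define k where "k = Suc j"
  have jn: "j < n" "k < n" using Suc.prems by (auto simp: k_def)
  define G where "G = chain_sum j (chain_sum k v)"
  define H where "H = t j (t k G)"
  have tG: "t j G = q *s G" using Suc.IH jn by (simp add: G_def k_def)
  have abs1: "t k (x + t k x) = q *s (x + t k x)" for x
    using jn by (simp add: t_add quad scale_left_diff_distrib scale_right_distrib)
  have "t j (t k (t j G)) = t k (t j (t k G))" using braid[of j G] jn by (simp add: k_def)
  then have qH: "q *s H = t k H" using tG jn by (simp add: t_scale H_def)
  have F: "chain_sum k (chain_sum (Suc k) v) = (chain_sum k v + t k (chain_sum k v)) + H"
  proof -
    have "chain_sum j (t k (chain_sum k v)) = t k G"
      using chain_sum_commutes[of j k] jn by (simp add: G_def k_def del: chain_sum.simps)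
    then have "t j (chain_sum j (chain_sum (Suc k) v)) = t j (chain_sum j v) + H"
      using jn by (simp add: chain_sum_add t_add H_def)
    then show ?thesis by (simp add: k_def algebra_simps)
  qed
  show ?case unfolding k_def[symmetric] F
    using jn by (simp only: t_add[OF jn(2), of _ H] abs1 qH[symmetric]) (simp only: scale_right_distrib)
qed

lemma perm_sum_absorb: "k \<le> n \<Longrightarrow> i < k \<Longrightarrow> t i (perm_sum k v) = q *s perm_sum k v"
proof (induction k arbitrary: v)
  case (Suc k)
  show ?case
  proof (cases "i = k")
    case False
    with Suc show ?thesis by simp
  next
    case True
    show ?thesis
    proof (cases k)
      case 0
      with True Suc.prems show ?thesis using chain_sum_absorb[of 0 v] by simp
    next
      case (Suc j)
      let ?w = "chain_sum k (chain_sum (Suc k) v)"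
      have scale: "l \<le> n \<Longrightarrow> perm_sum l (c *s x) = c *s perm_sum l x" for l c x
      proof -
        have 1: "l \<le> n \<Longrightarrow> chain_sum l (c *s x) = c *s chain_sum l x" for l c x
          by (induction l) (auto simp: t_scale scale_right_distrib)
        show "l \<le> n \<Longrightarrow> perm_sum l (c *s x) = c *s perm_sum l x"
          by (induction l arbitrary: x) (auto simp: 1 simp del: chain_sum.simps)
      qed
      have "perm_sum (Suc k) v = perm_sum j ?w" by (simp add: Suc del: chain_sum.simps)
      moreover have "t k (perm_sum j ?w) = perm_sum j (t k ?w)"
        using Suc.prems Suc by (intro perm_sum_commutes) auto
      ultimately show ?thesis using chain_sum_absorb[of k v] scale[of j q ?w] Suc.prems True Suc by simp
    qed
  qed
qed simp

text \<open>With \<open>perm_sum_absorb\<close> this identifies \<open>perm_sum k\<close>, divided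
  by the q-factorial, as a projection onto the common q-eigenspace.\<close>

lemma perm_sum_fix:
  "k \<le> n \<Longrightarrow> (\<And>i. i < k \<Longrightarrow> t i v = q *s v) \<Longrightarrow> perm_sum k v = qfact q (Suc k) *s v"
proof -
  have 1: "k \<le> n \<Longrightarrow> (\<And>i. i < k \<Longrightarrow> t i v = q *s v) \<Longrightarrow> chain_sum k v = qint q (Suc k) *s v" for k v
  proof (induction k)
    case (Suc k)
    then show ?case
      by (simp add: t_scale qint_Suc[of q "Suc k"] scale_left_distrib mult.commute)
  qed simp
  show "k \<le> n \<Longrightarrow> (\<And>i. i < k \<Longrightarrow> t i v = q *s v) \<Longrightarrow> perm_sum k v = qfact q (Suc k) *s v"
  proof (induction k arbitrary: v)
    case 0 then show ?case by (simp add: qfact_def)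
  next
    case (Suc k)
    have "chain_sum (Suc k) v = qint q (Suc (Suc k)) *s v" by (rule 1) (use Suc.prems in auto)
    moreover have "perm_sum k (c *s v) = qfact q (Suc k) *s c *s v" for c
      using Suc.prems by (intro Suc.IH) (auto simp: t_scale mult.commute)
    ultimately show ?case by (simp add: qfact_def mult.commute del: chain_sum.simps)
  qed
qed

text \<open>Words use the generators 1, 2, ... while the operators are numbered from 0; hence
  \<open>t (i - 1)\<close>.\<close>

lemma perm_sum_normal:
  "k \<le> n \<Longrightarrow> perm_sum k v = (\<Sum>w\<in>normal_words k. foldr (\<lambda>i. t (i - 1)) w v)"
proof (induction k arbitrary: v)
  case (Suc k)
  let ?op = "foldr (\<lambda>i. t (i - 1))"
  have t_sum: "i < n \<Longrightarrow> t i (\<Sum>x\<in>A. f x) = (\<Sum>x\<in>A. t i (f x))" for i f and A :: "'c set"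
    using t_scale[of i 0 0] by (induction A rule: infinite_finite_induct) (auto simp: t_add)
  have op_sum: "set w \<subseteq> {1..n} \<Longrightarrow> ?op w (\<Sum>x\<in>A. f x) = (\<Sum>x\<in>A. ?op w (f x))" for w f and A :: "'c set"
    by (induction w) (auto simp: t_sum)
  have chain: "j \<le> n \<Longrightarrow> chain_sum j v = (\<Sum>k=1..Suc j. ?op (rev [k..<Suc j]) v)" for j
  proof (induction j)
    case (Suc j)
    have "(\<Sum>k=1..Suc (Suc j). ?op (rev [k..<Suc (Suc j)]) v) = (\<Sum>k=1..Suc j. t j (?op (rev [k..<Suc j]) v)) + v"
      by (simp del: upt_Suc add: upt_Suc_append)
    also have "(\<Sum>k=1..Suc j. t j (?op (rev [k..<Suc j]) v)) = t j (chain_sum j v)"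
    proof -
      have "chain_sum j v = (\<Sum>k=1..Suc j. ?op (rev [k..<Suc j]) v)"
        by (rule Suc.IH) (use Suc.prems in simp)
      moreover have "j < n" using Suc.prems by simp
      ultimately show ?thesis by (simp only: t_sum)
    qed
    finally show ?case by (simp add: add.commute)
  qed simp
  have "perm_sum (Suc k) v = (\<Sum>w\<in>normal_words k. ?op w (\<Sum>j=1..k + 2. ?op (rev [j..<k + 2]) v))"
    using Suc chain[of "Suc k"] by (simp del: chain_sum.simps upt_Suc)
  also have "\<dots> = (\<Sum>w\<in>normal_words k. \<Sum>j=1..k + 2. ?op (w @ rev [j..<k + 2]) v)"
  proof (rule sum.cong[OF refl])
    fix w assume "w \<in> normal_words k"
    then have "set w \<subseteq> {1..n}" using normal_words_set[of w k] Suc.prems by auto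
    then show "?op w (\<Sum>j=1..k + 2. ?op (rev [j..<k + 2]) v) = (\<Sum>j=1..k + 2. ?op (w @ rev [j..<k + 2]) v)"
      by (simp only: op_sum foldr_append o_apply)
  qed
  also have "\<dots> = (\<Sum>(w, j)\<in>normal_words k \<times> {1..k + 2}. ?op (w @ rev [j..<k + 2]) v)"
    by (simp only: sum.cartesian_product)
  also have "\<dots> = (\<Sum>w\<in>normal_words (Suc k). ?op w v)"
    unfolding normal_words.simps by (subst sum.reindex[OF inj_normal_parts]) (auto simp: case_prod_unfold)
  finally show ?case .
qed simp

end

section \<open>Operators on tensor powers\<close>

lemma sum_fun_apply: "(\<Sum>a\<in>A. f a) x = (\<Sum>a\<in>A. f a x)"
  by (induction A rule: infinite_finite_induct) auto

definition fscale :: "'k::field \<Rightarrow> ('a \<Rightarrow> 'k) \<Rightarrow> 'a \<Rightarrow> 'k" where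
  "fscale c f = (\<lambda>w. c * f w)"

lemma fscale_apply [simp]: "fscale c f w = c * f w"
  by (simp add: fscale_def)

interpretation tensors: vector_space "fscale :: 'k::field \<Rightarrow> (nat list \<Rightarrow> 'k) \<Rightarrow> nat list \<Rightarrow> 'k"
  by unfold_locales (auto simp: fun_eq_iff algebra_simps)

lemma lspan_eq_span: "lspan S = tensors.span S"
proof -
  have *: "(\<lambda>w. \<Sum>f\<in>F. a f * f w) = (\<Sum>f\<in>F. fscale (a f) f)" for F and a :: "(nat list \<Rightarrow> 'a) \<Rightarrow> 'a"
    by (simp add: fun_eq_iff sum_fun_apply)
  show ?thesis unfolding lspan_def tensors.span_explicit * by (rule Collect_cong) blast
qed

lemma words_append: "u \<in> words d a \<Longrightarrow> v \<in> words d b \<Longrightarrow> u @ v \<in> words d (a + b)"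
  by (auto simp: words_def)

lemma words_appendE:
  assumes "w \<in> words d (a + b)"
  obtains u v where "w = u @ v" "u \<in> words d a" "v \<in> words d b"
proof (rule that[of "take a w" "drop a w"])
  show "take a w \<in> words d a" "drop a w \<in> words d b"
    using assms by (auto simp: words_def dest: in_set_takeD in_set_dropD)
qed simp

lemma words_append3E:
  assumes "w \<in> words d n" "a + b + c = n"
  obtains u x v where "w = u @ x @ v" "u \<in> words d a" "x \<in> words d b" "v \<in> words d c"
proof -
  have "w \<in> words d (a + (b + c))" using assms by (simp add: add.assoc)
  then obtain u w' where "w = u @ w'" "u \<in> words d a" and w': "w' \<in> words d (b + c)"
    by (rule words_appendE)
  moreover from w' obtain x v where "w' = x @ v" "x \<in> words d b" "v \<in> words d c"
    by (rule words_appendE)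
  ultimately show thesis using that by simp
qed

lemma words_length: "w \<in> words d n \<Longrightarrow> length w = n"
  by (simp add: words_def)

lemma finite_words [simp]: "finite (words d n)"
proof -
  have "words d n = {w. set w \<subseteq> {..<d} \<and> length w = n}" by (auto simp: words_def)
  then show ?thesis using finite_lists_length_eq[of "{..<d}" n] by simp
qed

text \<open>The operator of \<open>rhoT\<close>, with positions counted from 0 and extended by -1 to functions that are not
  supported on \<open>words d n\<close>: the Hecke relations then hold on all functions, and no eigenvector for \<open>q\<close>
  has support outside \<open>words d n\<close>.\<close>
definition tact :: "nat \<Rightarrow> nat \<Rightarrow> (nat list \<Rightarrow> nat list \<Rightarrow> 'k::field) \<Rightarrow> nat
    \<Rightarrow> (nat list \<Rightarrow> 'k) \<Rightarrow> nat list \<Rightarrow> 'k" where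
  "tact d n R i f w =
     (if w \<in> words d n then \<Sum>p\<in>words d 2. R (take 2 (drop i w)) p * f (take i w @ p @ drop (i + 2) w)
      else - f w)"

lemma tact_word:
  assumes "u @ x @ v \<in> words d n" "length u = i" "length x = 2"
  shows "tact d n R i f (u @ x @ v) = (\<Sum>p\<in>words d 2. R x p * f (u @ p @ v))"
  using assms by (simp add: tact_def)

text \<open>Fixing a prefix and a suffix turns the operators of a window into those on a short
  tensor power. The quadratic and braid relations and membership in \<open>Rel\<close> pass between
  short and long words in this way.\<close>

lemma tact_slice:
  assumes "u \<in> words d a" "x \<in> words d l" "v \<in> words d b" "i + 2 \<le> l"
  shows "tact d (a + l + b) R (a + i) f (u @ x @ v) = tact d l R i (\<lambda>x. f (u @ x @ v)) x"
proof -
  obtain x1 y x2 where x: "x = x1 @ y @ x2" and w: "x1 \<in> words d i" "y \<in> words d 2"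
    by (rule words_append3E[OF assms(2), of i 2 "l - i - 2"]) (use assms in auto)
  then have len: "length x1 = i" "length y = 2" by (auto simp: words_length)
  have "(u @ x1) @ y @ x2 @ v \<in> words d (a + l + b)"
    using words_append[OF words_append[OF assms(1,2)] assms(3)] by (simp add: x)
  then have "tact d (a + l + b) R (a + i) f ((u @ x1) @ y @ x2 @ v) =
      (\<Sum>p\<in>words d 2. R y p * f ((u @ x1) @ p @ x2 @ v))"
    using len assms by (intro tact_word) (auto simp: words_length)
  moreover have "tact d l R i (\<lambda>x. f (u @ x @ v)) (x1 @ y @ x2) = (\<Sum>p\<in>words d 2. R y p * f (u @ (x1 @ p @ x2) @ v))"
    using len assms x by (intro tact_word) auto
  ultimately show ?thesis by (simp add: x)
qed

lemma tact_cong: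
  assumes "x \<in> words d l" "i + 2 \<le> l" "\<And>y. y \<in> words d l \<Longrightarrow> f y = g y"
  shows "tact d l R i f x = tact d l R i g x"
proof -
  obtain u y v where x: "x = u @ y @ v" and w: "u \<in> words d i" "y \<in> words d 2" "v \<in> words d (l - i - 2)"
    by (rule words_append3E[OF assms(1), of i 2 "l - i - 2"]) (use assms in auto)
  have "i + (2 + (l - i - 2)) = l" using assms(2) by linarith
  then have "u @ p @ v \<in> words d l" if "p \<in> words d 2" for p
    using words_append[OF w(1) words_append[OF that w(3)]] by metis
  then show ?thesis
    using assms w by (simp add: x tact_word words_length)
qed

lemma tact_rhoT:
  assumes "w \<in> words d n" "1 \<le> i" "i < n"
  shows "tact d n R (i - 1) f w = (\<Sum>u\<in>words d n. rhoT n R i w u * f u)"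
proof -
  obtain x y z where w: "w = x @ y @ z" and len: "x \<in> words d (i - 1)" "y \<in> words d 2" "z \<in> words d (n - i - 1)"
    by (rule words_append3E[OF assms(1), of "i - 1" 2 "n - i - 1"]) (use assms in auto)
  have i: "Suc i = i - 1 + 2" using assms by simp
  have "(\<Sum>u\<in>words d n. rhoT n R i w u * f u) = (\<Sum>u\<in>(\<lambda>p. x @ p @ z) ` words d 2. rhoT n R i w u * f u)"
  proof (rule sum.mono_neutral_right)
    have "i - 1 + (2 + (n - i - 1)) = n" using assms by linarith
    then have "x @ p @ z \<in> words d n" if "p \<in> words d 2" for p
      using words_append[OF len(1) words_append[OF that len(3)]] by metis
    then show "(\<lambda>p. x @ p @ z) ` words d 2 \<subseteq> words d n" by blast
    show "\<forall>u\<in>words d n - (\<lambda>p. x @ p @ z) ` words d 2. rhoT n R i w u * f u = 0"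
    proof
      fix u assume u: "u \<in> words d n - (\<lambda>p. x @ p @ z) ` words d 2"
      then have "u \<in> words d n" by simp
      then obtain x' y' z' where u': "u = x' @ y' @ z'" "x' \<in> words d (i - 1)" "y' \<in> words d 2" "z' \<in> words d (n - i - 1)"
        by (rule words_append3E[of _ _ _ "i - 1" 2 "n - i - 1"]) (use assms in auto)
      have "\<not> (x = x' \<and> z = z')" using u u' by auto
      then have "rhoT n R i w u = 0"
        using len u' by (auto simp: rhoT_def w u'(1) words_length i)
      then show "rhoT n R i w u * f u = 0" by simp
    qed
  qed simp
  also have "\<dots> = (\<Sum>p\<in>words d 2. rhoT n R i w (x @ p @ z) * f (x @ p @ z))"
    by (subst sum.reindex) (auto simp: inj_on_def)
  also have "\<dots> = (\<Sum>p\<in>words d 2. R y p * f (x @ p @ z))"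
    using len by (intro sum.cong) (auto simp: rhoT_def w words_length i)
  also have "\<dots> = tact d n R (i - 1) f w"
    using assms len unfolding w by (intro tact_word[symmetric]) (auto simp: words_length)
  finally show ?thesis by simp
qed

lemma mat_mul_apply:
  "(\<Sum>u\<in>words d n. mat_mul d n A B w u * f u) = (\<Sum>v\<in>words d n. A w v * (\<Sum>u\<in>words d n. B v u * f u))"
proof -
  have "(\<Sum>u\<in>words d n. mat_mul d n A B w u * f u) = (\<Sum>u\<in>words d n. \<Sum>v\<in>words d n. A w v * (B v u * f u))"
    by (simp add: mat_mul_def sum_distrib_right mult.assoc)
  also have "\<dots> = (\<Sum>v\<in>words d n. \<Sum>u\<in>words d n. A w v * (B v u * f u))" by (rule sum.swap)
  finally show ?thesis by (simp add: sum_distrib_left)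
qed

lemma mat_id_apply: "w \<in> words d n \<Longrightarrow> (\<Sum>u\<in>words d n. mat_id w u * f u) = f w"
  by (simp add: mat_id_def if_distrib[of "\<lambda>x. x * _"] sum.delta cong: if_cong)

lemma tact_quad_2:
  assumes H: "hecke_operator d p q R" and w: "w \<in> words d 2"
  shows "tact d 2 R 0 (tact d 2 R 0 f) w = (q - 1) * tact d 2 R 0 f w + q * f w"
proof -
  have t2: "tact d 2 R 0 f w = (\<Sum>u\<in>words d 2. R w u * f u)" if "w \<in> words d 2" for f w
    using tact_word[of "[]" w "[]" d 2 0 R f] that by (simp add: words_length)
  let ?A = "\<lambda>a b. R a b + mat_id a b" and ?B = "\<lambda>a b. R a b - q * mat_id a b"
  have A: "(\<Sum>u\<in>words d 2. ?A w u * f u) = tact d 2 R 0 f w + f w" if "w \<in> words d 2" for f w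
    using mat_id_apply[OF that, of f] that by (simp add: t2 distrib_right sum.distrib)
  have B: "(\<Sum>u\<in>words d 2. ?B w u * f u) = tact d 2 R 0 f w - q * f w" if "w \<in> words d 2" for w
    using mat_id_apply[OF that, of f] that
    by (simp add: t2 left_diff_distrib sum_subtractf mult.assoc sum_distrib_left[symmetric])
  have "0 = (\<Sum>u\<in>words d 2. mat_mul d 2 ?A ?B w u * f u)"
    using H w by (simp add: hecke_operator_def)
  also have "\<dots> = (\<Sum>v\<in>words d 2. ?A w v * (tact d 2 R 0 f v - q * f v))"
    unfolding mat_mul_apply by (intro sum.cong) (simp_all add: B)
  also have "\<dots> = tact d 2 R 0 (\<lambda>v. tact d 2 R 0 f v - q * f v) w + (tact d 2 R 0 f w - q * f w)"
    by (rule A[OF w])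
  also have "tact d 2 R 0 (\<lambda>v. tact d 2 R 0 f v - q * f v) w = tact d 2 R 0 (tact d 2 R 0 f) w - q * tact d 2 R 0 f w"
    using w by (simp add: t2 right_diff_distrib sum_subtractf sum_distrib_left mult.left_commute)
  finally show ?thesis by (simp add: algebra_simps)
qed

lemma tact_braid_3:
  assumes H: "hecke_operator d p q R" and w: "w \<in> words d 3"
  shows "tact d 3 R 0 (tact d 3 R 1 (tact d 3 R 0 f)) w = tact d 3 R 1 (tact d 3 R 0 (tact d 3 R 1 f)) w"
proof -
  have t: "(\<Sum>u\<in>words d 3. rhoT 3 R 1 w u * f u) = tact d 3 R 0 f w"
    "(\<Sum>u\<in>words d 3. rhoT 3 R 2 w u * f u) = tact d 3 R 1 f w" if "w \<in> words d 3" for w f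
    using tact_rhoT[OF that, of 1 R f] tact_rhoT[OF that, of 2 R f] by simp_all
  have gen: "(\<Sum>u\<in>words d 3. mat_mul d 3 A (mat_mul d 3 B A) w u * f u) = P (Q (P f)) w"
    if A: "\<And>w f. w \<in> words d 3 \<Longrightarrow> (\<Sum>u\<in>words d 3. A w u * f u) = P f w"
      and B: "\<And>w f. w \<in> words d 3 \<Longrightarrow> (\<Sum>u\<in>words d 3. B w u * f u) = Q f w" for A B P Q
    using w by (simp add: mat_mul_apply A B cong: sum.cong)
  have "(\<Sum>u\<in>words d 3. mat_mul d 3 (rhoT 3 R 1) (mat_mul d 3 (rhoT 3 R 2) (rhoT 3 R 1)) w u * f u) =
      (\<Sum>u\<in>words d 3. mat_mul d 3 (rhoT 3 R 2) (mat_mul d 3 (rhoT 3 R 1) (rhoT 3 R 2)) w u * f u)"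
    using H w by (intro sum.cong) (auto simp: hecke_operator_def)
  then show ?thesis
    by (simp only: gen[of "rhoT 3 R 1" "tact d 3 R 0" "rhoT 3 R 2" "tact d 3 R 1", OF t]
        gen[of "rhoT 3 R 2" "tact d 3 R 1" "rhoT 3 R 1" "tact d 3 R 0", OF t(2,1)])
qed

lemma hecke_action_tact:
  assumes H: "hecke_operator d p q R" and q: "\<forall>n\<ge>1. qint q n \<noteq> 0"
  shows "hecke_action fscale q (tact d m R) (m - 1)"
proof (unfold_locales, goal_cases)
  case (1 i x y)
  show ?case by (auto simp: fun_eq_iff tact_def distrib_left sum.distrib)
next
  case (2 i c x)
  show ?case by (auto simp: fun_eq_iff tact_def sum_distrib_left mult.left_commute)
next
  case (3 i f)
  show ?case
  proof
    fix w
    show "tact d m R i (tact d m R i f) w = (fscale (q - 1) (tact d m R i f) + fscale q f) w"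
    proof (cases "w \<in> words d m")
      case False then show ?thesis by (simp add: tact_def algebra_simps)
    next
      case True
      have m: "m = i + 2 + (m - i - 2)" using 3 by simp
      obtain u x v where w: "w = u @ x @ v" "u \<in> words d i" "x \<in> words d 2" "v \<in> words d (m - i - 2)"
        by (rule words_append3E[OF True m[symmetric]])
      have sl: "tact d m R i g (u @ y @ v) = tact d 2 R 0 (\<lambda>x. g (u @ x @ v)) y" if "y \<in> words d 2" for g y
        using tact_slice[OF w(2) that w(4), of 0 R g, folded m] by simp
      have "tact d m R i (tact d m R i f) w = tact d 2 R 0 (\<lambda>x. tact d m R i f (u @ x @ v)) x"
        using w by (simp add: sl)
      also have "\<dots> = tact d 2 R 0 (tact d 2 R 0 (\<lambda>x. f (u @ x @ v))) x"
        using w by (intro tact_cong) (auto simp: sl)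
      finally show ?thesis using w by (simp add: tact_quad_2[OF H] sl)
    qed
  qed
next
  case (4 i f)
  show ?case
  proof
    fix w
    show "tact d m R i (tact d m R (Suc i) (tact d m R i f)) w =
        tact d m R (Suc i) (tact d m R i (tact d m R (Suc i) f)) w"
    proof (cases "w \<in> words d m")
      case False then show ?thesis by (simp add: tact_def)
    next
      case True
      have m: "m = i + 3 + (m - i - 3)" using 4 by simp
      obtain u x v where w: "w = u @ x @ v" "u \<in> words d i" "x \<in> words d 3" "v \<in> words d (m - i - 3)"
        by (rule words_append3E[OF True m[symmetric]])
      have sl: "tact d m R (i + j) g (u @ y @ v) = tact d 3 R j (\<lambda>x. g (u @ x @ v)) y"
        if "y \<in> words d 3" "j + 2 \<le> 3" for g y j
        using tact_slice[OF w(2) that(1) w(4) that(2), of R g, folded m] .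
      have *: "tact d m R (i + a) (tact d m R (i + b) (tact d m R (i + a) f)) w =
          tact d 3 R a (tact d 3 R b (tact d 3 R a (\<lambda>x. f (u @ x @ v)))) x" if ab: "a + 2 \<le> 3" "b + 2 \<le> 3" for a b
      proof -
        have "tact d m R (i + a) (tact d m R (i + b) (tact d m R (i + a) f)) w =
            tact d 3 R a (\<lambda>x. tact d m R (i + b) (tact d m R (i + a) f) (u @ x @ v)) x"
          using w ab by (simp add: sl)
        also have "\<dots> = tact d 3 R a (tact d 3 R b (\<lambda>x. tact d m R (i + a) f (u @ x @ v))) x"
          using w ab by (intro tact_cong) (auto simp: sl)
        also have "\<dots> = tact d 3 R a (tact d 3 R b (tact d 3 R a (\<lambda>x. f (u @ x @ v)))) x"
          using w ab by (intro tact_cong) (auto simp: sl)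
        finally show ?thesis .
      qed
      show ?thesis using *[of 0 1] *[of 1 0] tact_braid_3[OF H w(3)] by simp
    qed
  qed
next
  case (5 j i f)
  show ?case
  proof
    fix w
    show "tact d m R i (tact d m R j f) w = tact d m R j (tact d m R i f) w"
    proof (cases "w \<in> words d m")
      case False then show ?thesis by (simp add: tact_def)
    next
      case True
      \<comment> \<open>Cutting the word at both pairs of letters turns either side into the same
        double sum.\<close>
      obtain a x z where z: "w = a @ x @ z" "a \<in> words d i" "x \<in> words d 2" "z \<in> words d (m - i - 2)"
        by (rule words_append3E[OF True, of i 2 "m - i - 2"]) (use 5 in auto)
      obtain b y c where "z = b @ y @ c" "b \<in> words d (j - i - 2)" "y \<in> words d 2" "c \<in> words d (m - j - 2)"
        by (rule words_append3E[OF z(4), of "j - i - 2" 2 "m - j - 2"]) (use 5 in auto)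
      with z have w: "w = a @ x @ b @ y @ c" "a \<in> words d i" "x \<in> words d 2"
          "b \<in> words d (j - i - 2)" "y \<in> words d 2" "c \<in> words d (m - j - 2)" by auto
      have wd: "a @ x' @ b @ y' @ c \<in> words d m" if "x' \<in> words d 2" "y' \<in> words d 2" for x' y'
      proof -
        have "i + (2 + ((j - i - 2) + (2 + (m - j - 2)))) = m" using 5 by linarith
        then show ?thesis
          using words_append[OF w(2) words_append[OF that(1) words_append[OF w(4) words_append[OF that(2) w(6)]]]]
          by metis
      qed
      have ti: "tact d m R i g (a @ x' @ b @ y' @ c) = (\<Sum>p\<in>words d 2. R x' p * g (a @ p @ b @ y' @ c))"
        if "x' \<in> words d 2" "y' \<in> words d 2" for g x' y'
        using wd[OF that] that w by (intro tact_word) (auto simp: words_length)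
      have tj: "tact d m R j g (a @ x' @ b @ y' @ c) = (\<Sum>p\<in>words d 2. R y' p * g (a @ x' @ b @ p @ c))"
        if "x' \<in> words d 2" "y' \<in> words d 2" for g x' y'
        using tact_word[of "a @ x' @ b" y' c d m j R g] wd[OF that] that w 5 by (simp add: words_length)
      have "tact d m R i (tact d m R j f) w =
          (\<Sum>p\<in>words d 2. \<Sum>p'\<in>words d 2. R x p * (R y p' * f (a @ p @ b @ p' @ c)))"
        using w by (simp add: ti tj sum_distrib_left)
      also have "\<dots> = (\<Sum>p'\<in>words d 2. \<Sum>p\<in>words d 2. R x p * (R y p' * f (a @ p @ b @ p' @ c)))"
        by (rule sum.swap)
      also have "\<dots> = tact d m R j (tact d m R i f) w"
        using w by (simp add: ti tj sum_distrib_left mult.left_commute)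
      finally show ?thesis .
    qed
  qed
next
  case (6 k)
  then show ?case using q by simp
qed

lemma foldr_mat_mul_apply:
  assumes "set ws \<subseteq> {1..<n}" "w \<in> words d n"
  shows "(\<Sum>u\<in>words d n. foldr (\<lambda>i M. mat_mul d n (rhoT n R i) M) ws mat_id w u * f u)
    = foldr (\<lambda>i. tact d n R (i - 1)) ws f w"
  using assms
proof (induction ws arbitrary: w)
  case Nil
  then show ?case by (simp add: mat_id_apply)
next
  case (Cons i ws)
  let ?M = "foldr (\<lambda>i M. mat_mul d n (rhoT n R i) M) ws mat_id"
  have "(\<Sum>u\<in>words d n. mat_mul d n (rhoT n R i) ?M w u * f u) =
      (\<Sum>v\<in>words d n. rhoT n R i w v * foldr (\<lambda>i. tact d n R (i - 1)) ws f v)"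
    unfolding mat_mul_apply using Cons by (intro sum.cong) auto
  also have "\<dots> = tact d n R (i - 1) (foldr (\<lambda>i. tact d n R (i - 1)) ws f) w"
    using Cons.prems by (intro tact_rhoT[symmetric]) auto
  finally show ?case by simp
qed

lemma tact_eig_tspace:
  assumes "1 + q \<noteq> 0" "tact d n R i f = fscale q f"
  shows "f \<in> tspace d n"
  unfolding tspace_def
proof (intro CollectI allI impI, rule ccontr)
  fix w assume w: "f w \<noteq> 0" "w \<notin> words d n"
  have "q * f w = - f w" using fun_cong[OF assms(2), of w] w(2) by (simp add: tact_def)
  then have "(1 + q) * f w = 0" by (simp add: distrib_right)
  with assms(1) w(1) show False by simp
qed

text \<open>Each reduced expression chosen by \<open>SOME\<close> may be replaced by a normal word,
  so the matrix acts as \<open>perm_sum\<close> divided by the q-factorial. Absorption gives one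
  inclusion; \<open>perm_sum_fix\<close> shows that eigenvectors are their own images.\<close>

lemma relspace_eq:
  assumes H: "hecke_operator d p q R" and q: "\<forall>n\<ge>1. qint q n \<noteq> 0" and N: "N \<ge> 2"
  shows "relspace d q N R = {f. \<forall>i<N - 1. tact d N R i f = fscale q f}"
proof -
  define g where "g = N - 1"
  have Ng: "N = Suc g" "g \<ge> 1" using N by (auto simp: g_def)
  interpret hecke_action fscale q "tact d N R" g
    using hecke_action_tact[OF H q, of N] by (simp add: g_def)
  interpret br: braid_action "\<lambda>i. tact d N R (i - 1)" g
  proof
    fix i v assume "1 \<le> i" "i < g"
    then show "tact d N R (i - 1) (tact d N R (Suc i - 1) (tact d N R (i - 1) v)) =
        tact d N R (Suc i - 1) (tact d N R (i - 1) (tact d N R (Suc i - 1) v))"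
      using braid[of "i - 1" v] by simp
  next
    fix i j v assume "1 \<le> i" "j \<le> g" "Suc i < j"
    then show "tact d N R (i - 1) (tact d N R (j - 1) v) = tact d N R (j - 1) (tact d N R (i - 1) v)"
      by (intro comm) auto
  qed
  have qf: "qfact q N \<noteq> 0" using q by (simp add: qfact_def)
  have app: "mat_app d N (rho_qsym d q N R) f w = 1 / qfact q N * perm_sum g f w" if w: "w \<in> words d N" for f w
  proof -
    let ?op = "foldr (\<lambda>i. tact d N R (i - 1))"
    have "(\<Sum>u\<in>words d N. rho_Tperm d N R \<sigma> w u * f u) = ?op (SOME ws. reduced_expr (Suc g) ws \<sigma>) f w"
      if "\<sigma> permutes {1..Suc g}" for \<sigma>
      unfolding rho_Tperm_def Ng(1)[symmetric]
      using reduced_expr_some[OF that] w by (intro foldr_mat_mul_apply) (auto simp: reduced_expr_def Ng(1))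
    then have "(\<Sum>\<sigma>\<in>{\<sigma>. \<sigma> permutes {1..N}}. \<Sum>u\<in>words d N. rho_Tperm d N R \<sigma> w u * f u) =
        (\<Sum>\<sigma>\<in>{\<sigma>. \<sigma> permutes {1..Suc g}}. ?op (SOME ws. reduced_expr (Suc g) ws \<sigma>) f w)"
      by (intro sum.cong) (auto simp: Ng(1))
    also have "\<dots> = (\<Sum>x\<in>normal_words g. ?op x f w)"
      by (rule br.sum_reduced[of "\<lambda>h. h f w"])
    also have "\<dots> = perm_sum g f w" by (simp add: perm_sum_normal sum_fun_apply)
    finally have *: "(\<Sum>\<sigma>\<in>{\<sigma>. \<sigma> permutes {1..N}}. \<Sum>u\<in>words d N. rho_Tperm d N R \<sigma> w u * f u) = perm_sum g f w" .
    have "mat_app d N (rho_qsym d q N R) f w =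
        (\<Sum>u\<in>words d N. \<Sum>\<sigma>\<in>{\<sigma>. \<sigma> permutes {1..N}}. 1 / qfact q N * (rho_Tperm d N R \<sigma> w u * f u))"
      using w by (simp add: mat_app_def rho_qsym_def sum_distrib_left sum_distrib_right sum_divide_distrib)
    also have "\<dots> = (\<Sum>\<sigma>\<in>{\<sigma>. \<sigma> permutes {1..N}}. \<Sum>u\<in>words d N. 1 / qfact q N * (rho_Tperm d N R \<sigma> w u * f u))"
      by (rule sum.swap)
    finally show ?thesis by (simp only: sum_distrib_left[symmetric] *)
  qed
  have absorb: "tact d N R i (perm_sum g f) = fscale q (perm_sum g f)" if "i < g" for i f
    using that by (intro perm_sum_absorb) auto
  \<comment> \<open>Off \<open>words d N\<close> the left side is 0 by definition, and
    \<open>perm_sum g f\<close> vanishes there because it is a q-eigenvector of some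
    \<open>tact\<close>.\<close>
  have app': "mat_app d N (rho_qsym d q N R) f = fscale (1 / qfact q N) (perm_sum g f)" for f
  proof
    fix w
    have "perm_sum g f \<in> tspace d N"
      using tact_eig_tspace[OF one_plus_q absorb[of 0 f]] Ng by simp
    then show "mat_app d N (rho_qsym d q N R) f w = fscale (1 / qfact q N) (perm_sum g f) w"
    proof (cases "w \<in> words d N")
      case True
      then show ?thesis by (simp add: app)
    next
      case False
      with \<open>perm_sum g f \<in> tspace d N\<close> show ?thesis by (auto simp: mat_app_def tspace_def)
    qed
  qed
  show ?thesis
  proof (intro equalityI subsetI)
    fix r assume "r \<in> relspace d q N R"
    then obtain f where r: "r = fscale (1 / qfact q N) (perm_sum g f)" by (auto simp: relspace_def app')
    have "tact d N R i r = fscale q r" if "i < g" for i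
      unfolding r t_scale[OF that] absorb[OF that] by (simp add: fscale_def mult.left_commute)
    then show "r \<in> {f. \<forall>i<N - 1. tact d N R i f = fscale q f}" by (simp add: g_def)
  next
    fix f assume "f \<in> {f. \<forall>i<N - 1. tact d N R i f = fscale q f}"
    then have f: "\<And>i. i < g \<Longrightarrow> tact d N R i f = fscale q f" by (simp add: g_def)
    then have "f \<in> tspace d N" using tact_eig_tspace[OF one_plus_q f[of 0]] Ng by simp
    moreover have "mat_app d N (rho_qsym d q N R) f = f"
      unfolding app' using perm_sum_fix[OF le_refl f] qf by (simp add: Ng(1)[symmetric] fun_eq_iff)
    ultimately show "f \<in> relspace d q N R" unfolding relspace_def by (metis image_eqI)
  qed
qed

lemma in_block_le: "in_block N c a \<Longrightarrow> a + N \<le> sum_list c"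
  by (induction c arbitrary: a) (force simp: in_block_Cons)+

lemma tens_append: "length x = a \<Longrightarrow> tens a u v (x @ y) = u x * v y"
  by (simp add: tens_def)

text \<open>Product tensors with a relation in the window satisfy its eigenconditions. Conversely an
  element satisfying them is expanded along prefixes and suffixes of the window, and each slice in
  between satisfies the equations of \<open>Rel\<close>.\<close>

lemma Jsub_eq:
  assumes N: "N \<ge> 2" and q: "1 + q \<noteq> 0" and c: "sum_list c = m"
    and Rel: "Rel = {f. \<forall>i<N - 1. tact d N R i f = fscale q f}"
  shows "Jsub d N Rel c = tensors.span
    (\<Union>a\<in>{a. in_block N c a}. {f. \<forall>i\<in>{a..<a + N - 1}. tact d m R i f = fscale q f})"
    (is "_ = tensors.span (\<Union>a\<in>_. ?W a)")
proof -
  let ?gen = "{tens a u (tens N r v) | a b u r v.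
      u \<in> tspace d a \<and> r \<in> Rel \<and> v \<in> tspace d b \<and> a + N + b = sum_list c \<and> in_block N c a}"
  have RelT: "r \<in> tspace d N" if "r \<in> Rel" for r
    using that N tact_eig_tspace[OF q, of d N R 0 r] by (auto simp: Rel)
  have gen1: "tens a u (tens N r v) \<in> ?W a"
    if u: "u \<in> tspace d a" and r: "r \<in> Rel" and v: "v \<in> tspace d b" and m: "a + N + b = m" for a b u r v
  proof safe
    fix i assume i: "i \<in> {a..<a + N - 1}"
    let ?f = "tens a u (tens N r v)"
    show "tact d m R i ?f = fscale q ?f"
    proof
      fix w
      show "tact d m R i ?f w = fscale q ?f w"
      proof (cases "w \<in> words d m")
        case True
        then obtain x y z where w: "w = x @ y @ z" "x \<in> words d a" "y \<in> words d N" "z \<in> words d b"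
          by (rule words_append3E[OF _ m])
        have f: "?f (x @ y' @ z) = u x * (r y' * v z)" if "y' \<in> words d N" for y'
          using w that by (simp add: tens_append words_length)
        have i': "a + (i - a) = i" "i - a + 2 \<le> N" "i - a < N - 1" using i N by auto
        have "tact d m R i ?f w = tact d N R (i - a) (\<lambda>y. ?f (x @ y @ z)) y"
          using tact_slice[OF w(2-4) i'(2), of R ?f] by (simp only: m i' w)
        also have "\<dots> = tact d N R (i - a) (fscale (u x * v z) r) y"
          using w i' by (intro tact_cong) (auto simp: f)
        also have "\<dots> = (u x * v z) * tact d N R (i - a) r y"
          using w(3) by (simp add: tact_def sum_distrib_left mult.left_commute)
        also have "tact d N R (i - a) r y = q * r y" using r i' by (simp add: Rel)
        finally show ?thesis using w f by simp
      next
        case False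
        have "?f w = 0"
        proof (rule ccontr)
          assume "?f w \<noteq> 0"
          then have "take a w \<in> words d a" "take N (drop a w) \<in> words d N" "drop N (drop a w) \<in> words d b"
            using u v RelT[OF r] by (auto simp: tens_def tspace_def)
          from words_append[OF this(1) words_append[OF this(2,3)]]
          have "w \<in> words d (a + (N + b))" by (simp only: append_take_drop_id)
          with False m show False by (simp add: add.assoc)
        qed
        with False show ?thesis by (simp add: tact_def)
      qed
    qed
  qed
  have gen2: "f \<in> tensors.span ?gen" if a: "in_block N c a" and f: "f \<in> ?W a" for a f
  proof -
    define b where "b = m - (a + N)"
    have m: "a + N + b = m" using in_block_le[OF a] c by (simp add: b_def)
    have fT: "f \<in> tspace d m" using f N tact_eig_tspace[OF q, of d m R a f] by auto
    \<comment> \<open>\<open>e x\<close> is a basis tensor, and \<open>r x z\<close> the slice of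
      \<open>f\<close> between prefix x and suffix z. The slice is set to 0 off
      \<open>words d N\<close>, since \<open>tact\<close> is -1 there.\<close>
    define e :: "nat list \<Rightarrow> nat list \<Rightarrow> 'a" where "e x w = (if w = x then 1 else 0)" for x w
    define r where "r x z y = (if y \<in> words d N then f (x @ y @ z) else 0)" for x z y
    have rRel: "r x z \<in> Rel" if "x \<in> words d a" "z \<in> words d b" for x z
      unfolding Rel
    proof (intro CollectI allI impI ext)
      fix i y assume i: "i < N - 1"
      show "tact d N R i (r x z) y = fscale q (r x z) y"
      proof (cases "y \<in> words d N")
        case True
        have "tact d N R i (r x z) y = tact d N R i (\<lambda>y. f (x @ y @ z)) y"
          using True i by (intro tact_cong) (auto simp: r_def)
        also have "\<dots> = tact d m R (a + i) f (x @ y @ z)"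
          using tact_slice[OF that(1) True that(2), of i R f] i by (simp only: m)
        also have "\<dots> = q * f (x @ y @ z)" using f i by simp
        finally show ?thesis using True by (simp add: r_def)
      qed (simp add: tact_def r_def)
    qed
    have "f = (\<Sum>x\<in>words d a. \<Sum>z\<in>words d b. tens a (e x) (tens N (r x z) (e z)))"
    proof
      fix w
      have "tens a (e x) (tens N (r x z) (e z)) w =
        (if z = drop N (drop a w) then if x = take a w then r x z (take N (drop a w)) else 0 else 0)" for x z
        by (simp add: tens_def e_def)
      then have "(\<Sum>x\<in>words d a. \<Sum>z\<in>words d b. tens a (e x) (tens N (r x z) (e z))) w =
         (if take a w \<in> words d a \<and> drop N (drop a w) \<in> words d b
          then r (take a w) (drop N (drop a w)) (take N (drop a w)) else 0)"
        by (cases "drop (N + a) w \<in> words d b") (simp_all add: sum_fun_apply)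
      also have "\<dots> = f w"
      proof (cases "w \<in> words d m")
        case True
        then obtain x y z where "w = x @ y @ z" "x \<in> words d a" "y \<in> words d N" "z \<in> words d b"
          by (rule words_append3E[OF _ m])
        then show ?thesis by (simp add: r_def words_length)
      next
        case False
        have "\<not> (take a w \<in> words d a \<and> take N (drop a w) \<in> words d N \<and> drop N (drop a w) \<in> words d b)"
        proof safe
          assume "take a w \<in> words d a" "take N (drop a w) \<in> words d N" "drop N (drop a w) \<in> words d b"
          from words_append[OF this(1) words_append[OF this(2,3)]]
          have "w \<in> words d (a + (N + b))" by (simp only: append_take_drop_id)
          with False m show False by (simp add: add.assoc)
        qed
        with False fT show ?thesis by (auto simp: r_def tspace_def)
      qed
      finally show "f w = (\<Sum>x\<in>words d a. \<Sum>z\<in>words d b. tens a (e x) (tens N (r x z) (e z))) w" by simp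
    qed
    also have "\<dots> \<in> tensors.span ?gen"
    proof (intro tensors.span_sum tensors.span_base)
      fix x z assume xz: "x \<in> words d a" "z \<in> words d b"
      then have "e x \<in> tspace d a" "e z \<in> tspace d b" by (auto simp: e_def tspace_def)
      then show "tens a (e x) (tens N (r x z) (e z)) \<in> ?gen"
        using rRel[OF xz] a m unfolding c mem_Collect_eq by blast
    qed
    finally show ?thesis .
  qed
  have "Jsub d N Rel c = tensors.span ?gen"
    unfolding Jsub_def lspan_eq_span in_block_def ..
  also have "\<dots> = tensors.span (\<Union>a\<in>{a. in_block N c a}. ?W a)"
  proof (rule equalityI; rule tensors.span_minimal)
    show "?gen \<subseteq> tensors.span (\<Union>a\<in>{a. in_block N c a}. ?W a)"
    proof
      fix f assume "f \<in> ?gen"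
      then obtain a b u r v where f: "f = tens a u (tens N r v)" and *: "u \<in> tspace d a" "r \<in> Rel" "v \<in> tspace d b"
        "a + N + b = m" "in_block N c a" unfolding c by blast
      have "f \<in> ?W a" unfolding f by (rule gen1[OF *(1-4)])
      with *(5) show "f \<in> tensors.span (\<Union>a\<in>{a. in_block N c a}. ?W a)"
        by (intro tensors.span_base) blast
    qed
    show "(\<Union>a\<in>{a. in_block N c a}. ?W a) \<subseteq> tensors.span ?gen" using gen2 by blast
  qed simp_all
  finally show ?thesis .
qed

section \<open>The bar complex\<close>

text \<open>Applied to the projections \<open>\<pi> D\<close>, to evaluation at a word and to
  truncation.\<close>

lemma bd_additive:
  assumes h: "\<And>x y. h (x + y) = h x + h y"
  shows "bd (\<lambda>c. h (\<xi> c)) c = h (bd \<xi> c)"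
proof -
  interpret additive h by unfold_locales (rule h)
  show ?thesis by (induction c arbitrary: \<xi>) (auto simp: zero minus diff sum)
qed

lemma bd_eq_sum:
  fixes g :: "nat list \<Rightarrow> 'a::ring_1"
  shows "(\<Sum>j<length c. (-1) ^ Suc j * (\<Sum>x=1..<c ! j. g (take j c @ [x, c ! j - x] @ drop (Suc j) c))) = bd g c"
proof (induction c arbitrary: g)
  case (Cons b c)
  have "(\<Sum>j<length c. (-1) ^ Suc j * (\<Sum>x=1..<c ! j. g (b # take j c @ [x, c ! j - x] @ drop (Suc j) c)))
      = bd (\<lambda>r. g (b # r)) c" by (rule Cons.IH)
  then show ?case
    by (simp add: sum.lessThan_Suc_shift sum_negf del: sum.lessThan_Suc)
qed simp

lemma finite_compositions [simp]: "finite (compositions m i)"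
proof (rule finite_subset)
  show "compositions m i \<subseteq> {c. set c \<subseteq> {..m} \<and> length c = i}"
    by (auto simp: compositions_def member_le_sum_list)
qed (simp add: finite_lists_length_eq)

lemma sum_merge_blocks:
  assumes c': "c' \<in> compositions m l" and j: "j < l"
  shows "(\<Sum>c\<in>compositions m (Suc l). if merge_blocks j c = c' then g c else 0)
    = (\<Sum>x=1..<c' ! j. g (take j c' @ [x, c' ! j - x] @ drop (Suc j) c'))"
proof -
  have l: "length c' = l" using c' by (simp add: compositions_def)
  have "(\<Sum>c\<in>compositions m (Suc l). if merge_blocks j c = c' then g c else 0)
      = (\<Sum>c\<in>{c \<in> compositions m (Suc l). merge_blocks j c = c'}. g c)"
    by (simp add: sum.inter_filter)
  also have "\<dots> = (\<Sum>x=1..<c' ! j. g (take j c' @ [x, c' ! j - x] @ drop (Suc j) c'))"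
  proof (rule sum.reindex_bij_witness[of _ "\<lambda>x. take j c' @ [x, c' ! j - x] @ drop (Suc j) c'" "\<lambda>c. c ! j"])
    fix c assume "c \<in> {c \<in> compositions m (Suc l). merge_blocks j c = c'}"
    then have c: "length c = Suc l" "\<forall>b\<in>set c. 0 < b" and m: "merge_blocks j c = c'"
      by (auto simp: compositions_def)
    have nth: "c' ! j = c ! j + c ! Suc j" "take j c' = take j c" "drop (Suc j) c' = drop (Suc (Suc j)) c"
      using c j by (auto simp: m[symmetric] merge_blocks_def nth_append)
    have pos: "0 < c ! j" "0 < c ! Suc j" using c j by auto
    then show "c ! j \<in> {1..<c' ! j}" using nth by auto
    have "c = take j c @ [c ! j, c ! Suc j] @ drop (Suc (Suc j)) c"
      using c j by (simp add: Cons_nth_drop_Suc)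
    then show "take j c' @ [c ! j, c' ! j - c ! j] @ drop (Suc j) c' = c" using nth by simp
    then show "g (take j c' @ [c ! j, c' ! j - c ! j] @ drop (Suc j) c') = g c" by simp
  next
    fix x assume x: "x \<in> {1..<c' ! j}"
    let ?c = "take j c' @ [x, c' ! j - x] @ drop (Suc j) c'"
    have split: "c' = take j c' @ [c' ! j] @ drop (Suc j) c'"
      using l j by (simp add: Cons_nth_drop_Suc)
    have "sum_list c' = sum_list ?c" using x by (subst split) simp
    moreover have "\<forall>b\<in>set ?c. 0 < b"
      using c' x by (auto simp: compositions_def dest: in_set_takeD in_set_dropD)
    ultimately have "?c \<in> compositions m (Suc l)" using c' l j by (simp add: compositions_def)
    moreover have "merge_blocks j ?c = c'"
      using l j x split by (simp add: merge_blocks_def nth_append)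
    ultimately show "?c \<in> {c \<in> compositions m (Suc l). merge_blocks j c = c'}" by blast
    show "?c ! j = x" using l j by (simp add: nth_append)
  qed
  finally show ?thesis .
qed

lemma bar_diff_eq_bd:
  assumes "c \<in> compositions m l"
  shows "bar_diff m (Suc l) x c = bd x c"
proof
  fix w
  have "length c = l" using assms by (simp add: compositions_def)
  then have "bar_diff m (Suc l) x c w = bd (\<lambda>c. x c w) c"
    using assms by (simp add: bar_diff_def sum_merge_blocks bd_eq_sum[symmetric])
  then show "bar_diff m (Suc l) x c w = bd x c w"
    using bd_additive[of "\<lambda>f. f w" x c] by simp
qed

theorem theorem4p1:
  fixes d N :: nat and p :: "nat \<Rightarrow> bool" and q :: "'k::field"
    and R :: "nat list \<Rightarrow> nat list \<Rightarrow> 'k"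
  assumes "(2::'k) \<noteq> 0"
    and "N \<ge> 2"
    and "q \<noteq> 0"
    and "\<forall>n\<ge>1. qint q n \<noteq> 0"
    and "hecke_operator d p q R"
  shows "N_Koszul d N (relspace d q N R)"
  unfolding N_Koszul_def
proof (intro allI impI)
  fix i m assume im: "m \<noteq> nuN N i"
  define n where "n = m - 1"
  define I where "I = {..<n}"
  define J where "J = Jsub d N (relspace d q N R)"
  interpret H: hecke_action fscale q "tact d m R" n
    unfolding n_def using assms by (intro hecke_action_tact)
  have finI: "finite I" by (simp add: I_def)
  have dist: "H.distributes D (I - D)" if "D \<subseteq> I" for D
    using that unfolding I_def by (intro H.distributes_eig) auto
  obtain \<pi> :: "nat set \<Rightarrow> (nat list \<Rightarrow> 'k) \<Rightarrow> nat list \<Rightarrow> 'k" where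
    \<pi>_add: "\<And>D f g. \<pi> D (f + g) = \<pi> D f + \<pi> D g" and \<pi>_scale: "\<And>D c f. \<pi> D (fscale c f) = fscale c (\<pi> D f)"
    and \<pi>_sum: "\<And>f. (\<Sum>D\<in>Pow I. \<pi> D f) = f" and \<pi>_meet: "\<And>D f. D \<subseteq> I \<Longrightarrow> \<pi> D f \<in> H.meet D"
    and \<pi>_kill: "\<And>D i f. D \<subseteq> I \<Longrightarrow> i \<in> I - D \<Longrightarrow> f \<in> H.eig i \<Longrightarrow> \<pi> D f = 0"
    and \<pi>_\<pi>: "\<And>D D' f. D \<subseteq> I \<Longrightarrow> \<pi> D' (\<pi> D f) = (if D' = D then \<pi> D f else 0)"
    by (rule H.simultaneous_decomposition[OF finI dist]) (assumption, rule that, assumption+)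
  have add: "additive (\<pi> D)" for D by (rule additive.intro) (rule \<pi>_add)
  note \<pi>_0 = additive.zero[OF add] and \<pi>_diff = additive.diff[OF add]
    and \<pi>_setsum = additive.sum[OF add]
  let ?W = "\<lambda>a. {f. \<forall>i\<in>{a..<a + N - 1}. tact d m R i f = fscale q f}"
  have J_eq: "J c = tensors.span (\<Union>a\<in>{a. in_block N c a}. ?W a)" if "sum_list c = m" for c
    unfolding J_def using Jsub_eq[OF assms(2) H.one_plus_q that relspace_eq[OF assms(5,4,2)]] .
  \<comment> \<open>The eigenspace of a window is the sum of the pieces \<open>D\<close> containing
    its positions. So \<open>J c\<close> is the sum of the pieces on which \<open>c\<close> is not
    alive, that is, the common kernel of the other projections.\<close>
  have J_iff: "f \<in> J c \<longleftrightarrow> (\<forall>D\<subseteq>I. alive N D c \<longrightarrow> \<pi> D f = 0)" if c: "sum_list c = m" for f c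
  proof (intro iffI allI impI)
    fix D assume f: "f \<in> J c" and D: "D \<subseteq> I" "alive N D c"
    have "tensors.subspace {f. \<pi> D f = 0}"
      by (rule tensors.subspaceI) (simp_all add: \<pi>_0 \<pi>_add \<pi>_scale)
    moreover have "?W a \<subseteq> {f. \<pi> D f = 0}" if a: "in_block N c a" for a
    proof
      fix f assume f: "f \<in> ?W a"
      obtain i where i: "i \<in> {a..<a + N - 1}" "i \<notin> D" using D(2) a unfolding alive_def by blast
      then have "i \<in> I - D" using in_block_le[OF a] c by (auto simp: I_def n_def)
      moreover have "f \<in> H.eig i" using f i by (simp add: H.eig_def)
      ultimately show "f \<in> {f. \<pi> D f = 0}" using \<pi>_kill D(1) by blast
    qed
    ultimately have "J c \<subseteq> {f. \<pi> D f = 0}"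
      unfolding J_eq[OF c] by (intro tensors.span_minimal) blast+
    with f show "\<pi> D f = 0" by blast
  next
    assume *: "\<forall>D\<subseteq>I. alive N D c \<longrightarrow> \<pi> D f = 0"
    have "\<pi> D f \<in> J c" if D: "D \<in> Pow I" for D
    proof (cases "alive N D c")
      case True
      with * D show ?thesis unfolding J_eq[OF c] by (simp add: tensors.span_zero)
    next
      case False
      then obtain a where a: "in_block N c a" "{a..<a + N - 1} \<subseteq> D" unfolding alive_def by blast
      have "\<pi> D f \<in> ?W a"
      proof (intro CollectI ballI)
        fix i assume "i \<in> {a..<a + N - 1}"
        then have "i \<in> D" using a by blast
        then show "tact d m R i (\<pi> D f) = fscale q (\<pi> D f)"
          using \<pi>_meet[of D f] D by (auto simp: H.meet_def H.eig_def I_def)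
      qed
      with a show ?thesis unfolding J_eq[OF c] by (intro tensors.span_base) blast
    qed
    then have "(\<Sum>D\<in>Pow I. \<pi> D f) \<in> J c"
      unfolding J_eq[OF c] by (intro tensors.span_sum)
    then show "f \<in> J c" by (simp only: \<pi>_sum)
  qed
  have J_tspace: "f \<in> tspace d m" if "sum_list c = m" "f \<in> J c" for f c
  proof -
    have T: "tspace d m = {f :: nat list \<Rightarrow> 'k. \<forall>w. w \<notin> words d m \<longrightarrow> f w = 0}"
      by (auto simp: tspace_def)
    have "tensors.subspace (tspace d m :: (nat list \<Rightarrow> 'k) set)" unfolding T by (rule tensors.subspaceI) simp_all
    moreover have "?W a \<subseteq> tspace d m" for a
      using assms(2) tact_eig_tspace[OF H.one_plus_q, of d m R a] by auto
    ultimately have "J c \<subseteq> tspace d m"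
      unfolding J_eq[OF that(1)] by (intro tensors.span_minimal) blast+
    with that(2) show ?thesis by blast
  qed
  have comp: "c \<in> compositions m l \<longleftrightarrow> length c = l \<and> 0 \<notin> set c \<and> sum_list c = m" for c l
    by (auto simp: compositions_def intro!: gr0I)
  show "tor_vanishes d N (relspace d q N R) i m"
    unfolding tor_vanishes_def J_def[symmetric]
  proof (intro ballI impI)
    fix x :: "nat list \<Rightarrow> nat list \<Rightarrow> 'k"
    assume x: "x \<in> bar_chains d i m" and cyc: "\<forall>c\<in>compositions m (i - 1). bar_diff m i x c \<in> J c"
    \<comment> \<open>Where \<open>c\<close> is alive, \<open>\<pi> D\<close> kills
      \<open>J c\<close>, so a cycle modulo \<open>J\<close> becomes an exact cycle on the
      compositions alive for \<open>D\<close>, as \<open>alive_exact\<close> requires.\<close>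
    have "\<exists>\<eta>. \<forall>c. length c = i \<longrightarrow> 0 \<notin> set c \<longrightarrow> sum_list c = m \<longrightarrow> alive N D c \<longrightarrow> bd \<eta> c = \<pi> D (x c)"
      if D: "D \<subseteq> I" for D
    proof (rule alive_exact[OF assms(2) im])
      fix c assume c: "Suc (length c) = i" "0 \<notin> set c" "sum_list c = m" "alive N D c"
      then have cm: "c \<in> compositions m (i - 1)" by (auto simp: comp)
      with cyc have "bar_diff m i x c \<in> J c" by blast
      then have "bd x c \<in> J c" using bar_diff_eq_bd[OF cm, of x] c(1) by simp
      then have "\<pi> D (bd x c) = 0" using J_iff[OF c(3)] D c(4) by blast
      then show "bd (\<lambda>c. \<pi> D (x c)) c = 0" using bd_additive[of "\<pi> D" x c] \<pi>_add by simp
    qed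
    then have "\<exists>\<eta>. \<forall>D\<subseteq>I. \<forall>c. length c = i \<longrightarrow> 0 \<notin> set c \<longrightarrow> sum_list c = m \<longrightarrow> alive N D c \<longrightarrow>
        bd (\<eta> D) c = \<pi> D (x c)" by metis
    then obtain \<eta> where \<eta>: "\<And>D c. D \<subseteq> I \<Longrightarrow> c \<in> compositions m i \<Longrightarrow> alive N D c \<Longrightarrow> bd (\<eta> D) c = \<pi> D (x c)"
      unfolding comp by blast
    \<comment> \<open>The lifts \<open>\<eta> D\<close> are arbitrary functions on words, and the
      pieces split the space of all such functions. Truncation restores the support required of
      chains; the error \<open>z\<close> is unaffected, being in \<open>J c\<close> and hence
      supported on \<open>words d m\<close>.\<close>
    define trunc :: "(nat list \<Rightarrow> 'k) \<Rightarrow> nat list \<Rightarrow> 'k" where "trunc f w = (if w \<in> words d m then f w else 0)" for f w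
    \<comment> \<open>Projecting each lift to its own piece makes \<open>\<pi> D\<close> of the sum
      see \<open>\<eta> D\<close> alone.\<close>
    define y' where "y' c = trunc (\<Sum>D\<in>Pow I. \<pi> D (\<eta> D c))" for c
    define y where "y c = (if c \<in> compositions m (Suc i) then y' c else (\<lambda>_. 0))" for c
    have "y \<in> bar_chains d (Suc i) m"
      by (auto simp: bar_chains_def y_def y'_def trunc_def tspace_def)
    moreover have "(\<lambda>w. bar_diff m (Suc i) y c w - x c w) \<in> J c" if c: "c \<in> compositions m i" for c
    proof -
      have cm: "sum_list c = m" using c by (simp add: comp)
      define z where "z = (\<Sum>D\<in>Pow I. \<pi> D (bd (\<eta> D) c)) - x c"
      have "\<pi> D z = 0" if D: "D \<subseteq> I" "alive N D c" for D
      proof -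
        have "\<pi> D (\<Sum>D'\<in>Pow I. \<pi> D' (bd (\<eta> D') c)) = (\<Sum>D'\<in>Pow I. if D = D' then \<pi> D' (bd (\<eta> D') c) else 0)"
          unfolding \<pi>_setsum by (intro sum.cong) (auto simp: \<pi>_\<pi>)
        also have "\<dots> = \<pi> D (\<pi> D (x c))"
          using D \<eta>[OF D(1) c D(2)] by (simp add: I_def)
        finally show ?thesis using D(1) by (simp add: z_def \<pi>_diff \<pi>_\<pi>)
      qed
      then have zJ: "z \<in> J c" using J_iff[OF cm] by blast
      have "bar_diff m (Suc i) y c = bar_diff m (Suc i) y' c"
        by (auto simp: bar_diff_def y_def fun_eq_iff intro!: sum.cong)
      also have "\<dots> = bd y' c" by (rule bar_diff_eq_bd[OF c])
      also have "\<dots> = trunc (bd (\<lambda>c. \<Sum>D\<in>Pow I. \<pi> D (\<eta> D c)) c)"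
        unfolding y'_def by (rule bd_additive[of trunc]) (auto simp: trunc_def fun_eq_iff)
      also have "bd (\<lambda>c. \<Sum>D\<in>Pow I. \<pi> D (\<eta> D c)) c = (\<Sum>D\<in>Pow I. \<pi> D (bd (\<eta> D) c))"
        unfolding bd_sum by (rule sum.cong[OF refl], rule bd_additive[of "\<pi> D" for D], rule \<pi>_add)
      also have "\<dots> = z + x c" by (simp add: z_def)
      finally have "bar_diff m (Suc i) y c = trunc (z + x c)" .
      moreover have "z \<in> tspace d m" "x c \<in> tspace d m"
        using J_tspace[OF cm zJ] x by (auto simp: bar_chains_def)
      then have "z w = 0 \<and> x c w = 0" if "w \<notin> words d m" for w
        using that by (auto simp: tspace_def)
      ultimately have "(\<lambda>w. bar_diff m (Suc i) y c w - x c w) = z"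
        by (auto simp: fun_eq_iff trunc_def)
      with zJ show ?thesis by simp
    qed
    ultimately show "\<exists>y\<in>bar_chains d (Suc i) m. \<forall>c\<in>compositions m i.
        (\<lambda>w. bar_diff m (Suc i) y c w - x c w) \<in> J c" by blast
  qed
qed

end
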